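(* Let $\tau\in\mathbb{C}$ with $\mathrm{Im}(\tau)>0$, $q=e^{2\pi i\tau}$, and let $\alpha,u,v,z\in\mathbb{C}$. The function $\mu(u,v;\alpha)$ satisfies the following identities, each valid whenever all the terms in it are defined (i.e. the arguments of all $\mu$'s are in the domain of definition and no denominator vanishes): (i) $\mu(u+2\tau,v;\alpha)=\big(1-e^{2\pi i(u-v)}q\big)q^{\frac{\alpha}{2}}\mu(u+\tau,v;\alpha)+e^{2\pi i(u-v)}q\,\mu(u,v;\alpha)$. (ii) $\mu(u,v;\alpha)=e^{-\pi i\alpha}\mu(u+1,v;\alpha)=e^{\pi i\alpha}\mu(u,v+1;\alpha)$. (iii) $\mu(u+\tau,v;\alpha)=-e^{2\pi i(u-v)}q^{\frac{\alpha}{2}}\mu(u,v;\alpha)+e^{\pi i(u-v)}q^{\frac{\alpha}{2}}\mu(u,v;\alpha-1)$. (iv) $\mu(u-\tau,v;\alpha)=q^{\frac{\alpha}{2}}\mu(u,v;\alpha)-2i\,e^{-\pi i(u-v)}\sin(\pi\alpha\tau)\,\mu(u,v;\alpha+1)$. (v) $$\mu(u+z,v+z;\alpha)=\frac{\vartheta_{11}(u+z)\vartheta_{11}(v+z-\alpha\tau)}{\vartheta_{11}(u+z-\alpha\tau)\vartheta_{11}(v+z)}e^{2\pi i\alpha(u-v)}\mu(v,u;\alpha)$$ $$-\frac{i\,(q^\alpha)_\infty(q)_\infty^2\,q^{\frac{1-4\alpha}{8}}\,\vartheta_{11}(z)\vartheta_{11}(u+v+z-\alpha\tau)}{\vartheta_{11}(u)\vartheta_{11}(v-\alpha\tau)\vartheta_{11}(u+z-\alpha\tau)\vartheta_{11}(v+z)}\,e^{\pi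 i(\alpha-1)(u-v)}\,{}_1\phi_1\left(\begin{matrix}q^{1-\alpha}\\0\end{matrix};q,e^{-2\pi i(u-v)}q\right).$$ (vi) $\mu(u,v;\alpha)=\mu(u+\tau,v+\tau;\alpha)$. (vii) $\mu(u,v;\alpha)=\dfrac{\vartheta_{11}(v-\alpha\tau)\vartheta_{11}(u)}{\vartheta_{11}(u-\alpha\tau)\vartheta_{11}(v)}e^{2\pi i\alpha(u-v)}\mu(v,u;\alpha)$. (viii) $\mu(u,v;\alpha)=\dfrac{\vartheta_{11}(v-\alpha\tau)\vartheta_{11}(u)}{\vartheta_{11}(u-\alpha\tau)\vartheta_{11}(v)}e^{2\pi i\alpha(u-v)}\mu(-u+\alpha\tau,-v+\alpha\tau;\alpha)$. (ix) $2\cos(\pi(u-v))\,\mu(u,v;\alpha)=(1-q^{-\alpha})\mu(u,v;\alpha+1)+\mu(u,v;\alpha-1)$.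
   Context: Powers: $q^{s}:=e^{2\pi is\tau}$. $(x)_\infty=(x;q)_\infty=\prod_{j\ge0}(1-xq^j)$, $(x)_n=(x)_\infty/(q^nx)_\infty$. $\vartheta_{11}(u)=\sum_{n\in\mathbb{Z}}e^{2\pi i(n+\frac12)(u+\frac12)+\pi i(n+\frac12)^2\tau}$. ${}_1\phi_1\left(\begin{matrix}A\\0\end{matrix};q,x\right)=\sum_{n\ge0}\frac{(A)_n}{(q)_n}(-1)^nq^{n(n-1)/2}x^n$. Generalized $\mu$-function: for $\alpha,u,v\in\mathbb{C}$ with $u-\alpha\tau,v\notin\mathbb{Z}+\mathbb{Z}\tau$, $$\mu(u,v;\alpha)=\frac{e^{\pi i\alpha(u-v)}}{\vartheta_{11}(v)}\sum_{n\in\mathbb{Z}}(-1)^ne^{2\pi i(n+\frac12)v}q^{\frac{n(n+1)}2}\frac{(e^{2\pi iu}q^{n+1})_\infty}{(e^{2\pi iu}q^{n-\alpha+1})_\infty}.$$ *)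

theory Defs
  imports "HOL-Analysis.Analysis"
begin

(* q^s for a complex exponent s.  It is tied to the choice of tau, not to a branch of the
   logarithm of q = exp (2 pi i tau). *)
definition qpow :: "complex \<Rightarrow> complex \<Rightarrow> complex" where
  "qpow \<tau> s = exp (2 * pi * \<i> * s * \<tau>)"

definition qpoch_inf :: "complex \<Rightarrow> complex \<Rightarrow> complex" where
  "qpoch_inf x q = (\<Prod>j. 1 - x * q ^ j)"

(* (x;q)_n for n >= 0, as a finite product.  Lemma qpoch_eq_quotient below shows that this is
   (x;q)_inf / (q^n x;q)_inf whenever that quotient makes sense; the finite product also covers
   the removable case 0/0, which occurs when x is a power q^(-m) with n <= m. *)
definition qpoch :: "complex \<Rightarrow> complex \<Rightarrow> nat \<Rightarrow> complex" where
  "qpoch x q n = (\<Prod>j<n. 1 - x * q ^ j)"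

lemma convergent_prod_qpoch:
  fixes x q :: complex
  assumes "norm q < 1"
  shows "convergent_prod (\<lambda>j. 1 - x * q ^ j)"
proof -
  have "summable (\<lambda>j. norm (x * q ^ j))"
    using assms by (simp add: norm_mult norm_power summable_mult summable_geometric)
  then have "summable (\<lambda>j. norm ((1 - x * q ^ j) - 1))"
    by simp
  then have "abs_convergent_prod (\<lambda>j. 1 - x * q ^ j)"
    by (rule summable_imp_abs_convergent_prod)
  then show ?thesis
    by (rule abs_convergent_prod_imp_convergent_prod)
qed

lemma qpoch_eq_quotient:
  assumes "norm q < 1" and "qpoch_inf (q ^ n * x) q \<noteq> 0"
  shows "qpoch x q n = qpoch_inf x q / qpoch_inf (q ^ n * x) q"
proof -
  let ?f = "\<lambda>j. 1 - x * q ^ j"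
  have lim: "(\<lambda>N. \<Prod>j\<le>N. 1 - y * q ^ j) \<longlonglongrightarrow> qpoch_inf y q" for y
    unfolding qpoch_inf_def by (rule convergent_prod_LIMSEQ[OF convergent_prod_qpoch[OF assms(1)]])
  have split: "(\<Prod>j\<le>N + n. ?f j) = qpoch x q n * (\<Prod>j\<le>N. 1 - (q ^ n * x) * q ^ j)" for N
  proof -
    have "(\<Prod>j\<le>N + n. ?f j) = (\<Prod>j\<in>{..<n} \<union> {n..N + n}. ?f j)"
      by (rule prod.cong) auto
    also have "\<dots> = (\<Prod>j<n. ?f j) * (\<Prod>j=n..N + n. ?f j)"
      by (rule prod.union_disjoint) auto
    also have "(\<Prod>j=n..N + n. ?f j) = (\<Prod>j=0..N. ?f (j + n))"
      using prod.shift_bounds_cl_nat_ivl[of ?f 0 n N] by simp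
    also have "\<dots> = (\<Prod>j\<le>N. 1 - (q ^ n * x) * q ^ j)"
      by (simp add: power_add mult_ac atLeast0AtMost)
    finally show ?thesis by (simp add: qpoch_def)
  qed
  have "(\<lambda>N. \<Prod>j\<le>N + n. ?f j) \<longlonglongrightarrow> qpoch_inf x q"
    using lim[of x] by (rule LIMSEQ_ignore_initial_segment)
  moreover have "(\<lambda>N. \<Prod>j\<le>N + n. ?f j) \<longlonglongrightarrow> qpoch x q n * qpoch_inf (q ^ n * x) q"
    unfolding split by (intro tendsto_mult tendsto_const lim)
  ultimately have "qpoch_inf x q = qpoch x q n * qpoch_inf (q ^ n * x) q"
    by (rule LIMSEQ_unique)
  then show ?thesis using assms(2) by simp
qed

(* The basic hypergeometric series 1phi1 with lower parameter 0. *)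
definition phi11 :: "complex \<Rightarrow> complex \<Rightarrow> complex \<Rightarrow> complex" where
  "phi11 A q x = (\<Sum>n. qpoch A q n / qpoch q q n * (-1) ^ n * q ^ (n * (n - 1) div 2) * x ^ n)"

definition theta11 :: "complex \<Rightarrow> complex \<Rightarrow> complex" where
  "theta11 \<tau> u = (\<Sum>\<^sub>\<infinity>n\<in>(UNIV :: int set).
     exp (2 * pi * \<i> * (of_int n + 1/2) * (u + 1/2) + pi * \<i> * (of_int n + 1/2)\<^sup>2 * \<tau>))"

definition period_lattice :: "complex \<Rightarrow> complex set" where
  "period_lattice \<tau> = {of_int m + of_int n * \<tau> | (m :: int) (n :: int). True}"

definition mu_dom :: "complex \<Rightarrow> complex \<Rightarrow> complex \<Rightarrow> complex \<Rightarrow> bool" where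
  "mu_dom \<tau> u v \<alpha> \<longleftrightarrow> u - \<alpha> * \<tau> \<notin> period_lattice \<tau> \<and> v \<notin> period_lattice \<tau>"

(* The bilateral series converges absolutely on mu_dom, so the order of summation is immaterial.
   Its values outside mu_dom carry no meaning. *)
definition mu :: "complex \<Rightarrow> complex \<Rightarrow> complex \<Rightarrow> complex \<Rightarrow> complex" where
  "mu \<tau> u v \<alpha> =
     exp (pi * \<i> * \<alpha> * (u - v)) / theta11 \<tau> v *
     (\<Sum>\<^sub>\<infinity>n\<in>(UNIV :: int set).
        (-1) powi n * exp (2 * pi * \<i> * (of_int n + 1/2) * v) *
        qpow \<tau> (of_int n * (of_int n + 1) / 2) *
        (qpoch_inf (exp (2 * pi * \<i> * u) * qpow \<tau> (of_int n + 1)) (qpow \<tau> 1) /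
         qpoch_inf (exp (2 * pi * \<i> * u) * qpow \<tau> (of_int n - \<alpha> + 1)) (qpow \<tau> 1)))"

end

theory Submission
  imports Defs
begin

text \<open>
  Put \<open>x = exp (2 * pi * \<i> * u)\<close>, \<open>y = exp (2 * pi * \<i> * v)\<close>, \<open>a = q\<^sup>\<alpha>\<close>, write \<open>(X)\<close> for \<open>qpoch_inf X q\<close>, and let
  \<open>mu_series a x y\<close> be the bilateral sum inside \<open>mu\<close>.

  The identities that shift \<open>u\<close> by \<open>\<tau>\<close> or \<open>\<alpha>\<close> by one are linear relations between values of this series at
  neighbouring parameters.  They hold term by term, up to a shift of the index, because
  \<open>(X) = (1 - X) * (q * X)\<close>: this gives \<open>mu_series_lower_left\<close>, \<open>mu_series_lower_right\<close> and \<open>mu_series_raise\<close>, and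
  eliminating one of the three series involved gives the others.  The periodicity statements are
  reindexings.

  The behaviour under a simultaneous translation of \<open>u\<close> and \<open>v\<close> lies deeper.  Multiplying the series by the
  theta function of \<open>x / a\<close> clears all denominators (\<open>jtheta_times_mu_series\<close>, by the triple product): with
  \<open>X = x / a\<close> and \<open>c = y * a / x\<close> the result is, up to a constant times \<open>X\<close>, the sum over all integers \<open>n\<close> of
  \<open>c powi n * X powi (2 * n) * q powi (n * (n + 1)) * (q powi (- n) / X) * (a * X * q powi (n + 1))\<close>, called \<open>cleared_series a c X\<close> below.
  A translation changes \<open>X\<close> but not \<open>c\<close>.  Expanding the two infinite products by Euler and summing over
  \<open>n\<close> first, one finds a linear combination of two fixed theta functions of level two, with coefficients
  independent of \<open>X\<close> (\<open>cleared_series_in_span\<close>).  The \<open>2 \<times> 2\<close> determinants of values of these two functions are, up to an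
  elementary factor, products of two theta functions (\<open>theta2_determinant\<close>), so the values of \<open>cleared_series a c\<close> at any three points satisfy a linear
  relation with theta products as coefficients (\<open>cleared_series_three_term\<close>).  Take the three points \<open>x * t / a\<close>, \<open>1 / a\<close>
  and \<open>1 / y\<close>.  The first belongs to the translated function; at the second the bilateral series becomes
  one-sided and is the basic hypergeometric series; at the third the index change \<open>n \<mapsto> - n - 1\<close> identifies it
  with the series in which \<open>u\<close> and \<open>v\<close> are exchanged.  This is \<open>mu_series_transform\<close>.  Without translation one
  coefficient vanishes and the symmetry in \<open>u\<close> and \<open>v\<close> remains, while the reflection \<open>u \<mapsto> \<alpha> * \<tau> - u\<close>,
  \<open>v \<mapsto> \<alpha> * \<tau> - v\<close> is that same index change alone.
\<close>

section \<open>Absolutely convergent bilateral and double series\<close>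

(* Two constants share this infix; it is to mean summability of norms over a set. *)
no_notation Infinite_Set_Sum.abs_summable_on (infix "abs'_summable'_on" 50)

text \<open>
  The ratio test run along both ends of the integers.  Every bilateral series below is controlled by
  ratios that tend to zero in both directions.
\<close>

lemma abs_summable_on_int_ratio:
  fixes f :: "int \<Rightarrow> 'a::real_normed_vector"
  assumes up: "\<And>n. norm (f (int n + 1)) \<le> \<rho> n * norm (f (int n))" and "\<rho> \<longlonglongrightarrow> 0"
    and dn: "\<And>n. norm (f (- int n - 1)) \<le> \<sigma> n * norm (f (- int n))" and "\<sigma> \<longlonglongrightarrow> 0"
  shows "f abs_summable_on UNIV"
proof -
  have ray: "(\<lambda>n. norm (g n)) summable_on (UNIV :: nat set)"
    if g: "\<And>n. norm (g (Suc n)) \<le> \<rho> n * norm (g n)" and \<rho>: "\<rho> \<longlonglongrightarrow> 0"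
    for g :: "nat \<Rightarrow> 'a" and \<rho>
  proof -
    have "eventually (\<lambda>n. \<rho> n < 1/2) sequentially"
      using \<rho> by (rule order_tendstoD) simp
    then obtain N where N: "\<And>n. n \<ge> N \<Longrightarrow> \<rho> n < 1/2"
      unfolding eventually_sequentially by blast
    have "summable (\<lambda>n. norm (g n))"
    proof (rule summable_ratio_test)
      fix n assume "n \<ge> N"
      then have "\<rho> n * norm (g n) \<le> 1/2 * norm (g n)"
        using N by (intro mult_right_mono) (auto simp: less_imp_le)
      then show "norm (norm (g (Suc n))) \<le> 1/2 * norm (norm (g n))"
        using g[of n] by simp
    qed simp
    then show ?thesis by (subst summable_on_UNIV_nonneg_real_iff) auto
  qed
  have "(\<lambda>n. norm (f (int n))) summable_on UNIV"
    by (rule ray[OF _ assms(2)]) (use up in \<open>simp add: add.commute\<close>)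
  then have 1: "f abs_summable_on range int"
    by (subst summable_on_reindex) (auto simp: o_def)
  have "- int (Suc n) = - int n - 1" for n by simp
  then have "(\<lambda>n. norm (f (- int n))) summable_on UNIV"
    by (intro ray[OF _ assms(4)]) (simp only: dn)
  then have 2: "f abs_summable_on range (\<lambda>n. - int n)"
    by (subst summable_on_reindex) (auto simp: o_def inj_on_def)
  have "(UNIV :: int set) = range int \<union> range (\<lambda>n. - int n)"
    by (auto intro: int_cases2)
  then show ?thesis using summable_on_union[OF 1 2] by simp
qed

lemma abs_summable_on_times:
  fixes f :: "'a \<Rightarrow> 'c::{real_normed_div_algebra,banach}" and g :: "'b \<Rightarrow> 'c"
  assumes "f abs_summable_on A" and "g abs_summable_on B"
  shows "(\<lambda>(x, y). f x * g y) abs_summable_on A \<times> B"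
proof -
  have *: "(\<lambda>p. norm (f (fst p)) * norm (g (snd p))) summable_on A \<times> B"
  proof (rule summable_on_SigmaI)
    show "((\<lambda>y. norm (f (fst (x, y))) * norm (g (snd (x, y)))) has_sum norm (f x) * infsum (\<lambda>y. norm (g y)) B) B" for x
      using has_sum_cmult_right[OF has_sum_infsum[OF assms(2)]] by simp
    show "(\<lambda>x. norm (f x) * infsum (\<lambda>y. norm (g y)) B) summable_on A"
      by (rule summable_on_cmult_left[OF assms(1)])
  qed simp
  then show ?thesis by (simp add: case_prod_unfold norm_mult)
qed

lemma infsum_times:
  fixes f :: "'a \<Rightarrow> 'c::{real_normed_field,banach}" and g :: "'b \<Rightarrow> 'c"
  assumes "f abs_summable_on A" and "g abs_summable_on B"
  shows "infsum f A * infsum g B = (\<Sum>\<^sub>\<infinity>(x, y)\<in>A \<times> B. f x * g y)"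
proof -
  have s: "(\<lambda>(x, y). f x * g y) summable_on A \<times> B"
    using abs_summable_summable[OF abs_summable_on_times[OF assms]] .
  show ?thesis
    using infsum_Sigma_banach[OF s] by (simp add: infsum_cmult_right' infsum_cmult_left')
qed

lemma infsum_eq_suminf:
  fixes f :: "nat \<Rightarrow> complex"
  assumes "summable (\<lambda>n. norm (f n))"
  shows "infsum f UNIV = suminf f"
  by (rule infsumI, rule norm_summable_imp_has_sum[OF assms])
     (rule summable_sums[OF summable_norm_cancel[OF assms]])

lemma abs_summable_on_nat_iff:
  "(f :: nat \<Rightarrow> complex) abs_summable_on UNIV \<longleftrightarrow> summable (\<lambda>n. norm (f n))"
  by (rule summable_on_UNIV_nonneg_real_iff) simp

lemma infsum_int_eq_infsum_nat:
  fixes f :: "int \<Rightarrow> complex"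
  assumes "\<And>n. n < 0 \<Longrightarrow> f n = 0"
  shows "infsum f UNIV = (\<Sum>\<^sub>\<infinity>n. f (int n))"
proof -
  have "infsum f UNIV = infsum f (range int)"
  proof (rule infsum_cong_neutral)
    fix n assume "n \<in> UNIV - range int"
    then have "n < 0" by (metis DiffD2 int_nat_eq not_less rangeI)
    then show "f n = 0" by (rule assms)
  qed auto
  also have "\<dots> = infsum (f \<circ> int) UNIV"
    by (rule infsum_reindex) simp
  finally show ?thesis by (simp add: o_def)
qed

lemma infsum_int_shift: "(\<Sum>\<^sub>\<infinity>n\<in>UNIV. f (n + m)) = infsum f UNIV"
  for f :: "int \<Rightarrow> complex"
  by (rule infsum_reindex_bij_betw) (rule bij_betw_byWitness[of _ "\<lambda>n. n - m"], auto)

lemma abs_summable_on_int_geometric_ratio: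
  fixes f :: "int \<Rightarrow> complex"
  assumes f: "\<And>k. f (k + 1) = f k * (A * p powi k)"
    and "A \<noteq> 0" and p: "p \<noteq> 0" "norm p < 1"
  shows "f abs_summable_on UNIV"
proof (rule abs_summable_on_int_ratio)
  have lim: "(\<lambda>n. norm p ^ n) \<longlonglongrightarrow> 0"
    using p by (intro LIMSEQ_power_zero) simp
  show "norm (f (int n + 1)) \<le> (norm A * norm p ^ n) * norm (f (int n))" for n
    unfolding f by (simp add: norm_mult norm_power mult_ac)
  show "(\<lambda>n. norm A * norm p ^ n) \<longlonglongrightarrow> 0"
    using tendsto_mult[OF tendsto_const lim] by simp
  show "norm (f (- int n - 1)) \<le> (norm p / norm A * norm p ^ n) * norm (f (- int n))" for n
  proof -
    have "f (- int n) = f (- int n - 1) * (A * p powi (- int n - 1))"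
      using f[of "- int n - 1"] by simp
    also have "p powi (- int n - 1) = 1 / (p ^ n * p)"
      using p by (simp add: power_int_diff power_int_minus field_simps)
    finally have "f (- int n - 1) = f (- int n) * (p ^ n * p) / A"
      using assms by (simp add: field_simps)
    then show ?thesis by (simp add: norm_mult norm_divide norm_power mult_ac)
  qed
  show "(\<lambda>n. norm p / norm A * norm p ^ n) \<longlonglongrightarrow> 0"
    using tendsto_mult[OF tendsto_const[of "norm p / norm A"] lim] by simp
qed

section \<open>Infinite q-Pochhammer symbols and the expansions of Euler\<close>

locale nome =
  fixes q :: complex
  assumes norm_q: "norm q < 1" and q_nz [simp]: "q \<noteq> 0"
begin

lemma qpoch_LIMSEQ: "(\<lambda>N. qpoch x q N) \<longlonglongrightarrow> qpoch_inf x q"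
proof -
  have "(\<lambda>N. \<Prod>j\<le>N. 1 - x * q ^ j) \<longlonglongrightarrow> qpoch_inf x q"
    unfolding qpoch_inf_def by (rule convergent_prod_LIMSEQ[OF convergent_prod_qpoch[OF norm_q]])
  then have "(\<lambda>N. qpoch x q (Suc N)) \<longlonglongrightarrow> qpoch_inf x q"
    by (simp add: qpoch_def lessThan_Suc_atMost)
  then show ?thesis by (rule LIMSEQ_imp_Suc)
qed

lemma qpoch_Suc: "qpoch x q (Suc n) = qpoch x q n * (1 - x * q ^ n)"
  by (simp add: qpoch_def)

lemma qpoch_Suc_shift: "qpoch x q (Suc n) = (1 - x) * qpoch (x * q) q n"
  unfolding qpoch_def by (subst prod.lessThan_Suc_shift) (simp add: mult_ac)

lemma qpoch_inf_shift: "qpoch_inf x q = (1 - x) * qpoch_inf (x * q) q"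
proof (rule LIMSEQ_unique)
  show "(\<lambda>N. qpoch x q (Suc N)) \<longlonglongrightarrow> qpoch_inf x q"
    by (rule LIMSEQ_Suc[OF qpoch_LIMSEQ])
  show "(\<lambda>N. qpoch x q (Suc N)) \<longlonglongrightarrow> (1 - x) * qpoch_inf (x * q) q"
    unfolding qpoch_Suc_shift by (intro tendsto_mult tendsto_const qpoch_LIMSEQ)
qed

text \<open>
  Unlike the quotient formula for the finite symbol, this holds also where the infinite products vanish.
\<close>

lemma qpoch_inf_split: "qpoch_inf x q = qpoch x q n * qpoch_inf (x * q ^ n) q"
proof (induction n)
  case (Suc n)
  have "qpoch_inf (x * q ^ n) q = (1 - x * q ^ n) * qpoch_inf (x * q ^ Suc n) q"
    using qpoch_inf_shift[of "x * q ^ n"] by (simp add: mult_ac)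
  then show ?case using Suc by (simp add: qpoch_Suc)
qed (simp add: qpoch_def)

lemma qpoch_inf_nonzero:
  assumes "\<And>j::nat. x * q ^ j \<noteq> 1"
  shows "qpoch_inf x q \<noteq> 0"
  unfolding qpoch_inf_def
  by (rule prodinf_nonzero[OF convergent_prod_qpoch[OF norm_q]]) (use assms in \<open>metis eq_iff_diff_eq_0\<close>)

lemma qpoch_inf_eq_0:
  assumes "x * q ^ j = 1"
  shows "qpoch_inf x q = 0"
proof -
  have "qpoch x q (Suc j) = 0" using assms by (simp add: qpoch_Suc)
  then show ?thesis by (subst qpoch_inf_split[of _ "Suc j"]) simp
qed

lemma q_power_neq_1: "n > 0 \<Longrightarrow> q ^ n \<noteq> 1"
  using norm_q by (metis norm_one norm_power power_Suc_less_one norm_ge_zero gr0_conv_Suc less_irrefl q_nz zero_less_norm_iff)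

lemma qpoch_q_nonzero [simp]: "qpoch q q n \<noteq> 0"
  using q_power_neq_1[of "Suc _"] by (simp add: qpoch_def)

lemma qpoch_inf_q_nonzero [simp]: "qpoch_inf q q \<noteq> 0"
  by (rule qpoch_inf_nonzero) (use q_power_neq_1[of "Suc _"] in simp)

text \<open>
  Both expansions of Euler rest on one principle: a power series \<open>f\<close> that converges near \<open>0\<close>
  and satisfies \<open>f x = (1 - x) * f (q * x)\<close> is continuous at \<open>0\<close>, so iterating the
  equation forces \<open>f x = qpoch_inf x q * f 0\<close>.
\<close>

lemma qpoch_inf_unique:
  assumes "isCont f 0" and f: "\<And>k. f (x * q ^ k) = (1 - x * q ^ k) * f (x * q ^ Suc k)"
  shows "f x = qpoch_inf x q * f 0"
proof -
  have it: "f x = qpoch x q N * f (x * q ^ N)" for N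
  proof (induction N)
    case (Suc N)
    then show ?case by (simp only: qpoch_Suc f[of N] mult.assoc)
  qed (simp add: qpoch_def)
  have "(\<lambda>N. x * q ^ N) \<longlonglongrightarrow> x * 0"
    by (intro tendsto_mult tendsto_const LIMSEQ_power_zero norm_q)
  then have "(\<lambda>N. f (x * q ^ N)) \<longlonglongrightarrow> f 0"
    using isCont_tendsto_compose[OF assms(1)] by simp
  then have "(\<lambda>N. qpoch x q N * f (x * q ^ N)) \<longlonglongrightarrow> qpoch_inf x q * f 0"
    by (intro tendsto_mult qpoch_LIMSEQ)
  then show ?thesis
    unfolding it[symmetric] by (rule LIMSEQ_const_iff[THEN iffD1])
qed

text \<open>
  The coefficients of the first of the two expansions of Euler, \<open>qpoch_inf x q = (\<Sum>k. euler_coeff k * x ^ k)\<close>.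
\<close>

definition euler_coeff :: "nat \<Rightarrow> complex" where
  "euler_coeff k = (-1) ^ k * q ^ (k * (k - 1) div 2) / qpoch q q k"

lemma euler_coeff_0 [simp]: "euler_coeff 0 = 1"
  by (simp add: euler_coeff_def qpoch_def)

lemma euler_coeff_Suc: "euler_coeff (Suc k) * (1 - q ^ Suc k) = - (euler_coeff k * q ^ k)"
proof -
  have "Suc k * k = 2 * k + k * (k - 1)" by (cases k) auto
  then have "Suc k * (Suc k - 1) div 2 = k + k * (k - 1) div 2" by simp
  then show ?thesis
    using q_power_neq_1[of "Suc k"]
    by (simp add: euler_coeff_def qpoch_Suc power_add field_simps del: mult_Suc)
qed

lemma norm_q_power_tendsto_0: "(\<lambda>k. norm q ^ k) \<longlonglongrightarrow> 0"
  using norm_q by (intro LIMSEQ_power_zero) simp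

lemma one_minus_norm_q_le: "1 - norm q \<le> norm (1 - q ^ Suc k)"
proof -
  have "norm (q ^ Suc k) \<le> norm q"
    using norm_q by (simp add: norm_power norm_mult mult_left_le_one_le power_le_one mult_left_le)
  then show ?thesis using norm_triangle_ineq2[of 1 "q ^ Suc k"] by simp
qed

lemma summable_norm_ratio:
  fixes a :: "nat \<Rightarrow> complex"
  assumes "\<And>k. norm (a (Suc k)) \<le> \<rho> k * norm (a k)" and "\<rho> \<longlonglongrightarrow> c" and "c < 1"
  shows "summable (\<lambda>k. norm (a k))"
proof -
  obtain d where d: "c < d" "d < 1" using assms(3) dense by blast
  obtain N where N: "\<And>n. n \<ge> N \<Longrightarrow> \<rho> n < d"
    using order_tendstoD(2)[OF assms(2) d(1)] unfolding eventually_sequentially by blast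
  show ?thesis
  proof (rule summable_ratio_test[OF d(2)])
    fix n assume "n \<ge> N"
    then have "\<rho> n * norm (a n) \<le> d * norm (a n)"
      using N by (intro mult_right_mono) (auto simp: less_imp_le)
    then show "norm (norm (a (Suc n))) \<le> d * norm (norm (a n))"
      using assms(1)[of n] by simp
  qed
qed

lemma summable_euler_coeff: "summable (\<lambda>k. norm (euler_coeff k * x ^ k))"
proof (rule summable_norm_ratio)
  fix k
  have "norm (euler_coeff (Suc k)) * (1 - norm q) \<le> norm (euler_coeff (Suc k)) * norm (1 - q ^ Suc k)"
    using one_minus_norm_q_le by (rule mult_left_mono) simp
  also have "\<dots> = norm (euler_coeff k) * norm q ^ k"
    unfolding norm_mult[symmetric] euler_coeff_Suc by (simp add: norm_mult norm_power)
  finally have "norm (euler_coeff (Suc k)) \<le> norm (euler_coeff k) * norm q ^ k / (1 - norm q)"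
    using norm_q by (simp add: field_simps)
  then have "norm (euler_coeff (Suc k)) * norm (x ^ Suc k)
      \<le> (norm (euler_coeff k) * norm q ^ k / (1 - norm q)) * norm (x ^ Suc k)"
    by (rule mult_right_mono) simp
  then show "norm (euler_coeff (Suc k) * x ^ Suc k)
      \<le> (norm q ^ k * norm x / (1 - norm q)) * norm (euler_coeff k * x ^ k)"
    by (simp add: norm_mult norm_power mult_ac)
next
  show "(\<lambda>k. norm q ^ k * norm x / (1 - norm q)) \<longlonglongrightarrow> 0 * norm x / (1 - norm q)"
    using norm_q by (intro tendsto_intros norm_q_power_tendsto_0) simp
qed simp

text \<open>
  The power series satisfies the functional equation because its coefficients satisfy \<open>euler_coeff_Suc\<close>.
\<close>

lemma euler_product: "qpoch_inf x q = (\<Sum>k. euler_coeff k * x ^ k)"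
proof -
  define f where "f = (\<lambda>x. \<Sum>k. euler_coeff k * x ^ k)"
  have s: "summable (\<lambda>k. euler_coeff k * y ^ k)" for y
    by (rule summable_norm_cancel[OF summable_euler_coeff])
  have "isCont f 0"
    unfolding f_def by (rule isCont_powser_converges_everywhere[OF s])
  moreover have "f y = (1 - y) * f (y * q)" for y
  proof -
    have "f y - f (y * q) = (\<Sum>k. euler_coeff k * y ^ k - euler_coeff k * (y * q) ^ k)"
      unfolding f_def by (rule suminf_diff[OF s s])
    also have "\<dots> = (\<Sum>k. euler_coeff (Suc k) * y ^ Suc k - euler_coeff (Suc k) * (y * q) ^ Suc k)"
      by (subst suminf_split_head[OF summable_diff[OF s s]]) simp
    also have "\<dots> = (\<Sum>k. (- y) * (euler_coeff k * (y * q) ^ k))"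
    proof (rule suminf_cong)
      fix k
      have "euler_coeff (Suc k) * y ^ Suc k - euler_coeff (Suc k) * (y * q) ^ Suc k
          = (euler_coeff (Suc k) * (1 - q ^ Suc k)) * y ^ Suc k"
        by (simp add: power_mult_distrib algebra_simps)
      then show "euler_coeff (Suc k) * y ^ Suc k - euler_coeff (Suc k) * (y * q) ^ Suc k
          = (- y) * (euler_coeff k * (y * q) ^ k)"
        unfolding euler_coeff_Suc by (simp add: power_mult_distrib)
    qed
    also have "\<dots> = (- y) * f (y * q)"
      unfolding f_def by (rule suminf_mult[OF s])
    finally show ?thesis by (simp add: algebra_simps)
  qed
  then have "f (x * q ^ k) = (1 - x * q ^ k) * f (x * q ^ Suc k)" for k
    by (metis mult.assoc power_Suc2)
  ultimately have "f x = qpoch_inf x q * f 0"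
    by (rule qpoch_inf_unique)
  then show ?thesis by (simp add: f_def)
qed

lemma summable_inverse_qpoch:
  assumes "norm x < 1"
  shows "summable (\<lambda>k. norm (x ^ k / qpoch q q k))"
proof (rule summable_norm_ratio)
  fix k
  show "norm (x ^ Suc k / qpoch q q (Suc k)) \<le> (norm x / norm (1 - q ^ Suc k)) * norm (x ^ k / qpoch q q k)"
    by (simp only: qpoch_Suc norm_divide norm_mult norm_power power_Suc times_divide_times_eq mult_ac order_refl)
next
  have "(\<lambda>k. norm (1 - q ^ Suc k)) \<longlonglongrightarrow> norm (1 - 0 :: complex)"
    by (intro tendsto_intros LIMSEQ_Suc LIMSEQ_power_zero norm_q)
  then show "(\<lambda>k. norm x / norm (1 - q ^ Suc k)) \<longlonglongrightarrow> norm x / 1"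
    by (intro tendsto_intros) auto
qed (use assms in simp)

text \<open>
  Here the series satisfies the equation of \<open>1 / qpoch_inf x q\<close>, so the principle is applied to its reciprocal.
\<close>

lemma euler_inverse_product:
  assumes "norm x < 1"
  shows "(\<Sum>k. x ^ k / qpoch q q k) * qpoch_inf x q = 1"
proof -
  define f where "f = (\<lambda>x. \<Sum>k. x ^ k / qpoch q q k)"
  have s: "summable (\<lambda>k. y ^ k / qpoch q q k)" if "norm y < 1" for y
    by (rule summable_norm_cancel[OF summable_inverse_qpoch[OF that]])
  have fe: "f (y * q) = (1 - y) * f y" if y: "norm y < 1" for y
  proof -
    have yq: "norm (y * q) < 1"
      using y norm_q mult_strict_mono'[of "norm y" 1 "norm q" 1] by (simp add: norm_mult)
    have "f y - f (y * q) = (\<Sum>k. y ^ k / qpoch q q k - (y * q) ^ k / qpoch q q k)"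
      unfolding f_def by (rule suminf_diff[OF s[OF y] s[OF yq]])
    also have "\<dots> = (\<Sum>k. y ^ Suc k / qpoch q q (Suc k) - (y * q) ^ Suc k / qpoch q q (Suc k))"
      by (subst suminf_split_head[OF summable_diff[OF s[OF y] s[OF yq]]]) simp
    also have "\<dots> = (\<Sum>k. y * (y ^ k / qpoch q q k))"
    proof (rule suminf_cong)
      fix k
      have "y ^ Suc k / qpoch q q (Suc k) - (y * q) ^ Suc k / qpoch q q (Suc k)
          = y ^ Suc k * (1 - q ^ Suc k) / (qpoch q q k * (1 - q ^ Suc k))"
        by (simp add: power_mult_distrib qpoch_Suc diff_divide_distrib algebra_simps)
      then show "y ^ Suc k / qpoch q q (Suc k) - (y * q) ^ Suc k / qpoch q q (Suc k)
          = y * (y ^ k / qpoch q q k)"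
        using q_power_neq_1[of "Suc k"] by simp
    qed
    also have "\<dots> = y * f y"
      unfolding f_def by (rule suminf_mult[OF s[OF y]])
    finally show ?thesis by (simp add: algebra_simps)
  qed
  define g where "g = (\<lambda>y. inverse (f y))"
  have c: "isCont f 0"
    using isCont_powser[of "\<lambda>k. inverse (qpoch q q k)" "1/2" 0] s[of "1/2"]
    by (simp add: f_def field_simps)
  have f0: "f 0 = 1"
    using powser_zero[of "\<lambda>k. inverse (qpoch q q k)"]
    by (simp add: f_def field_simps qpoch_def)
  have ne: "1 - x * q ^ k \<noteq> 0" for k
  proof -
    have "norm (x * q ^ k) \<le> norm x"
      using norm_q by (simp add: norm_mult norm_power mult_left_le power_le_one)
    then have "norm (x * q ^ k) < 1" using assms by simp
    then show ?thesis by auto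
  qed
  have "isCont g 0"
    unfolding g_def using c f0 by (intro continuous_intros) auto
  moreover have "g (x * q ^ k) = (1 - x * q ^ k) * g (x * q ^ Suc k)" for k
  proof -
    have "norm (x * q ^ k) \<le> norm x"
      using norm_q by (simp add: norm_mult norm_power mult_left_le power_le_one)
    then have "f (x * q ^ Suc k) = (1 - x * q ^ k) * f (x * q ^ k)"
      using fe[of "x * q ^ k"] assms by (simp add: mult_ac)
    then show ?thesis using ne[of k] unfolding g_def by simp
  qed
  ultimately have "g x = qpoch_inf x q * g 0"
    by (rule qpoch_inf_unique)
  then have "inverse (f x) = qpoch_inf x q" by (simp add: g_def f0)
  moreover have "qpoch_inf x q \<noteq> 0"
    by (rule qpoch_inf_nonzero) (use ne in auto)
  ultimately have "f x * qpoch_inf x q = 1" by (metis inverse_zero right_inverse)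
  then show ?thesis by (simp only: f_def)
qed

end

section \<open>Jacobi theta series and the triple product\<close>

text \<open>
  The exponent of the theta series, as an integer so that it can be used for negative indices.
\<close>

definition tri :: "int \<Rightarrow> int" where
  "tri n = n * (n - 1) div 2"

lemma two_tri: "2 * tri n = n * (n - 1)"
  unfolding tri_def by simp

lemma of_int_tri: "of_int (tri n) = of_int n * (of_int n - 1) / (2 :: complex)"
proof -
  have "of_int (2 * tri n) = (of_int (n * (n - 1)) :: complex)"
    by (simp only: two_tri)
  then show ?thesis by (simp add: field_simps)
qed

lemma tri_add: "tri (m + n) = tri m + tri n + m * n"
proof -
  have "2 * tri (m + n) = 2 * (tri m + tri n + m * n)"
    unfolding distrib_left two_tri by (simp add: algebra_simps)
  then show ?thesis by simp
qed

lemma tri_plus_1: "tri (n + 1) = tri n + n"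
  by (simp add: tri_add) (simp add: tri_def)

lemma tri_of_nat: "tri (int k) = int (k * (k - 1) div 2)"
  by (cases k) (simp_all add: tri_def zdiv_int algebra_simps)

text \<open>
  Turns an identity of monomials into an identity between polynomial exponents.
\<close>

lemma powi_eq_exp: "z \<noteq> 0 \<Longrightarrow> z powi m = exp (of_int m * Ln z)" for z :: complex
  by (metis exp_Ln exp_power_int)

context nome
begin

text \<open>
  Up to an elementary factor this is \<open>theta11\<close> in the multiplicative variable (\<open>theta11_eq\<close> below); the sign lives in the base \<open>- X\<close>.
\<close>

definition jtheta :: "complex \<Rightarrow> complex" where
  "jtheta X = (\<Sum>\<^sub>\<infinity>n\<in>UNIV. q powi tri n * (- X) powi n)"

lemma jtheta_abs_summable:
  assumes "X \<noteq> 0"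
  shows "(\<lambda>n. q powi tri n * (- X) powi n) abs_summable_on UNIV"
proof (rule abs_summable_on_int_geometric_ratio)
  show "q powi tri (k + 1) * (- X) powi (k + 1) = q powi tri k * (- X) powi k * (- X * q powi k)" for k
    using assms by (simp add: tri_plus_1 power_int_add)
qed (use assms norm_q in auto)

text \<open>
  Quasi-periodicity for all integer shifts at once, by reindexing the series.
\<close>

lemma jtheta_shift:
  assumes X: "X \<noteq> 0"
  shows "jtheta X = q powi tri m * (- X) powi m * jtheta (X * q powi m)"
proof -
  have "jtheta X = (\<Sum>\<^sub>\<infinity>n\<in>UNIV. q powi tri (n + m) * (- X) powi (n + m))"
    unfolding jtheta_def by (rule infsum_int_shift[symmetric])
  also have "\<dots> = (\<Sum>\<^sub>\<infinity>n\<in>UNIV. (q powi tri m * (- X) powi m) * (q powi tri n * (- (X * q powi m)) powi n))"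
  proof (rule infsum_cong)
    fix n
    have "(- (X * q powi m)) powi n = (- X) powi n * q powi (m * n)"
      by (simp add: power_int_mult flip: power_int_mult_distrib)
    then show "q powi tri (n + m) * (- X) powi (n + m)
        = (q powi tri m * (- X) powi m) * (q powi tri n * (- (X * q powi m)) powi n)"
      using X by (simp add: tri_add power_int_add mult_ac)
  qed
  finally show ?thesis unfolding jtheta_def infsum_cmult_right' .
qed

lemma jtheta_times_q: "X \<noteq> 0 \<Longrightarrow> jtheta X = - X * jtheta (X * q)"
  using jtheta_shift[of X 1] by (simp add: tri_def)

text \<open>
  The involution \<open>n \<mapsto> 1 - n\<close> pairs each term with its negative.
\<close>

lemma jtheta_1: "jtheta 1 = 0"
proof -
  have "jtheta 1 = (\<Sum>\<^sub>\<infinity>n\<in>UNIV. q powi tri (1 - n) * (- 1) powi (1 - n))"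
    unfolding jtheta_def
    by (rule infsum_reindex_bij_betw[symmetric, of "\<lambda>n. 1 - n"])
       (rule bij_betw_byWitness[of _ "\<lambda>n. 1 - n"], auto)
  also have "\<dots> = (\<Sum>\<^sub>\<infinity>n\<in>UNIV. (-1) * (q powi tri n * (- 1) powi n))"
  proof (rule infsum_cong)
    fix n :: int
    have "tri (1 - n) = tri n" by (simp add: tri_def algebra_simps)
    moreover have "(- 1 :: complex) powi (1 - n) = (-1) * (- 1) powi n"
      by (simp add: power_int_diff power_int_minus_one_minus divide_inverse flip: power_int_minus)
    ultimately show "q powi tri (1 - n) * (- 1) powi (1 - n) = (-1) * (q powi tri n * (- 1) powi n)"
      by simp
  qed
  finally have "jtheta 1 = (-1) * jtheta 1"
    unfolding jtheta_def infsum_cmult_right' .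
  then show ?thesis by simp
qed

text \<open>
  Evaluate the sum over \<open>n\<close> of \<open>q powi tri n * (- X) powi n * qpoch_inf (q powi (n + 1)) q\<close> in two ways.
  The infinite product vanishes for negative \<open>n\<close>, so the first expansion of Euler sums the series
  to \<open>qpoch_inf q q * qpoch_inf X q\<close>.  If instead the product is expanded and the sum over \<open>n\<close> is
  taken first, each inner sum is a shifted theta series, and what remains is the second expansion
  of Euler in \<open>q / X\<close>, which needs \<open>norm q < norm X\<close>.
\<close>

lemma jacobi_triple_product_exterior:
  assumes X: "norm X > norm q"
  shows "jtheta X = qpoch_inf q q * qpoch_inf X q * qpoch_inf (q / X) q"
proof -
  have X0 [simp]: "X \<noteq> 0" using X by auto
  define t where "t n = q powi tri n * (- X) powi n" for n
  (* The double series is the product of the theta terms t and the terms c of the second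
     expansion of Euler, with the theta index shifted by k. *)
  define c where "c k = (q / X) ^ k / qpoch q q k" for k
  have qX: "norm (q / X) < 1" using X by (simp add: norm_divide)
  have cs: "c abs_summable_on UNIV"
    unfolding abs_summable_on_nat_iff c_def by (rule summable_inverse_qpoch[OF qX])
  have ts: "t abs_summable_on UNIV"
    unfolding t_def by (rule jtheta_abs_summable) simp
  have bij: "bij_betw (\<lambda>(k, n). (k, n + int k)) UNIV UNIV"
    by (rule bij_betw_byWitness[of _ "\<lambda>(k, n). (k, n - int k)"]) auto
  have prod_s: "(\<lambda>(k, n). c k * t n) summable_on UNIV"
    using abs_summable_summable[OF abs_summable_on_times[OF cs ts]] by simp
  then have sh_s: "(\<lambda>(k, n). c k * t (n + int k)) summable_on UNIV \<times> UNIV"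
    using summable_on_reindex_bij_betw[OF bij, of "\<lambda>(k, n). c k * t n"]
    by (simp add: case_prod_unfold)
  have term_eq: "c k * t (n + int k) = t n * (euler_coeff k * (q powi (n + 1)) ^ k)" for k n
  proof -
    have "(- X) powi (n + int k) = (- X) powi n * (- X) ^ k"
      by (simp add: power_int_add)
    moreover have "q powi tri (n + int k) = q powi tri n * q ^ (k * (k - 1) div 2) * (q powi n) ^ k"
      by (simp add: tri_add tri_of_nat power_int_add power_int_mult)
    moreover have "(q powi (n + 1)) ^ k = (q powi n) ^ k * q ^ k"
      by (simp add: power_int_add power_mult_distrib)
    moreover have "(- X) ^ k = (-1) ^ k * X ^ k"
      by (rule power_minus)
    ultimately show ?thesis
      by (simp add: t_def c_def euler_coeff_def power_divide field_simps)
  qed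
  have "infsum c UNIV * infsum t UNIV = (\<Sum>\<^sub>\<infinity>(k, n)\<in>UNIV \<times> UNIV. c k * t n)"
    by (rule infsum_times[OF cs ts])
  also have "\<dots> = (\<Sum>\<^sub>\<infinity>(k, n)\<in>UNIV \<times> UNIV. c k * t (n + int k))"
    using infsum_reindex_bij_betw[OF bij, of "\<lambda>(k, n). c k * t n"]
    by (simp add: case_prod_unfold)
  also have "\<dots> = (\<Sum>\<^sub>\<infinity>k. \<Sum>\<^sub>\<infinity>n. c k * t (n + int k))"
    using infsum_Sigma'_banach[OF sh_s] by simp
  also have "\<dots> = (\<Sum>\<^sub>\<infinity>n. \<Sum>\<^sub>\<infinity>k. c k * t (n + int k))"
    by (rule infsum_swap_banach[OF sh_s])
  also have "\<dots> = (\<Sum>\<^sub>\<infinity>n. t n * qpoch_inf (q powi (n + 1)) q)"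
    by (simp only: term_eq infsum_cmult_right' euler_product infsum_eq_suminf[OF summable_euler_coeff])
  also have "\<dots> = (\<Sum>\<^sub>\<infinity>n. t (int n) * qpoch_inf (q powi (int n + 1)) q)"
  proof (rule infsum_int_eq_infsum_nat)
    fix n :: int assume "n < 0"
    then have "q powi (n + 1) * q ^ nat (- n - 1) = q powi ((n + 1) + int (nat (- n - 1)))"
      by (simp only: power_int_add q_nz power_int_of_nat simp_thms)
    also have "\<dots> = 1" using \<open>n < 0\<close> by simp
    finally show "t n * qpoch_inf (q powi (n + 1)) q = 0"
      using qpoch_inf_eq_0 by simp
  qed
  also have "\<dots> = (\<Sum>\<^sub>\<infinity>n. qpoch_inf q q * (euler_coeff n * X ^ n))"
  proof (rule infsum_cong)
    fix n
    have "qpoch_inf (q powi (int n + 1)) q = qpoch_inf q q / qpoch q q n"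
      using qpoch_inf_split[of q n] by (simp add: power_int_add mult.commute)
    moreover have "(- X) ^ n = (-1) ^ n * X ^ n"
      by (rule power_minus)
    ultimately show "t (int n) * qpoch_inf (q powi (int n + 1)) q = qpoch_inf q q * (euler_coeff n * X ^ n)"
      by (simp add: t_def euler_coeff_def tri_of_nat)
  qed
  also have "\<dots> = qpoch_inf q q * qpoch_inf X q"
    by (simp only: infsum_cmult_right' euler_product infsum_eq_suminf[OF summable_euler_coeff])
  finally have "infsum c UNIV * jtheta X = qpoch_inf q q * qpoch_inf X q"
    by (simp add: t_def[abs_def] jtheta_def)
  moreover have inv: "infsum c UNIV * qpoch_inf (q / X) q = 1"
    using euler_inverse_product[OF qX] infsum_eq_suminf[of c] cs
    by (simp add: abs_summable_on_nat_iff c_def[abs_def])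
  moreover have "jtheta X = (infsum c UNIV * jtheta X) * qpoch_inf (q / X) q"
    using inv by (simp add: mult_ac)
  ultimately show ?thesis by simp
qed

text \<open>
  Both sides satisfy \<open>f X = - X * f (q * X)\<close>, which carries the identity inwards from the exterior of the disc.
\<close>

theorem jacobi_triple_product:
  assumes "X \<noteq> 0"
  shows "jtheta X = qpoch_inf q q * qpoch_inf X q * qpoch_inf (q / X) q"
proof -
  have "jtheta X = qpoch_inf q q * qpoch_inf X q * qpoch_inf (q / X) q"
    if "norm X > norm q ^ Suc k" for k and X
    using that
  proof (induction k arbitrary: X)
    case 0
    then show ?case by (intro jacobi_triple_product_exterior) simp
  next
    case (Suc k)
    have X: "X \<noteq> 0"
      using Suc.prems norm_ge_zero[of "q ^ Suc (Suc k)"] unfolding norm_power by (auto simp del: power_Suc norm_ge_zero)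
    have "norm (X / q) > norm q ^ Suc k"
      using Suc.prems by (simp add: norm_divide field_simps)
    from Suc.IH[OF this]
    have "jtheta (X / q) = qpoch_inf q q * qpoch_inf (X / q) q * qpoch_inf (q * q / X) q"
      by simp
    moreover have "qpoch_inf (X / q) q = (1 - X / q) * qpoch_inf X q"
      using qpoch_inf_shift[of "X / q"] by simp
    moreover have "qpoch_inf (q / X) q = (1 - q / X) * qpoch_inf (q * q / X) q"
      using qpoch_inf_shift[of "q / X"] by simp
    moreover have "jtheta (X / q) = - (X / q) * jtheta X"
      using jtheta_times_q[of "X / q"] X by simp
    ultimately have "- (X / q) * jtheta X
        = (1 - X / q) * (qpoch_inf q q * qpoch_inf X q * qpoch_inf (q * q / X) q)"
      by (simp only: mult_ac)
    also have "1 - X / q = - (X / q) * (1 - q / X)"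
      using X by (simp add: field_simps)
    finally have "jtheta X = (1 - q / X) * (qpoch_inf q q * qpoch_inf X q * qpoch_inf (q * q / X) q)"
      using X by simp
    then show ?case
      using \<open>qpoch_inf (q / X) q = _\<close> by (simp only: mult_ac)
  qed
  moreover obtain k where "norm q ^ k < norm X"
    using real_arch_pow_inv[of "norm X" "norm q"] assms norm_q by auto
  moreover have "norm q ^ Suc k \<le> norm q ^ k"
    using norm_q by (intro power_decreasing) auto
  ultimately show ?thesis by (metis le_less_trans)
qed

lemma jtheta_nonzero:
  assumes "X \<noteq> 0" and "\<And>n. X \<noteq> q powi n"
  shows "jtheta X \<noteq> 0"
proof -
  have "X * q ^ j \<noteq> 1" for j :: nat
    using assms(2)[of "- int j"] by (auto simp: power_int_minus field_simps)
  moreover have "q / X * q ^ j \<noteq> 1" for j :: nat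
    using assms(1) assms(2)[of "int j + 1"] by (auto simp: power_int_add field_simps)
  ultimately show ?thesis
    unfolding jacobi_triple_product[OF assms(1)] by (simp add: qpoch_inf_nonzero)
qed

section \<open>Theta functions of level two\<close>

text \<open>
  For fixed \<open>c\<close>, the sums over a parity class of monomials \<open>X powi m\<close> with the Gaussian weights forced by
  the equation \<open>f X = c * q\<^sup>2 * X\<^sup>2 * f (q * X)\<close>.  Its holomorphic solutions on the punctured
  plane form a two-dimensional space, spanned by the cases
  \<open>e = 0\<close> and \<open>e = 1\<close>.
\<close>

definition theta2 :: "complex \<Rightarrow> int \<Rightarrow> complex \<Rightarrow> complex" where
  "theta2 c e X = (\<Sum>\<^sub>\<infinity>k\<in>UNIV. c powi k * X powi (2 * k + e) * q powi (k * k + k * (1 + e)))"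

lemma theta2_abs_summable:
  assumes "c \<noteq> 0" "X \<noteq> 0"
  shows "(\<lambda>k. c powi k * X powi (2 * k + e) * q powi (k * k + k * (1 + e))) abs_summable_on UNIV"
proof (rule abs_summable_on_int_geometric_ratio)
  fix k
  have "2 * (k + 1) + e = (2 * k + e) + 2" "(k + 1) * (k + 1) + (k + 1) * (1 + e)
      = (k * k + k * (1 + e)) + (2 + e) + k * 2"
    by (auto simp: algebra_simps)
  then show "c powi (k + 1) * X powi (2 * (k + 1) + e) * q powi ((k + 1) * (k + 1) + (k + 1) * (1 + e))
      = c powi k * X powi (2 * k + e) * q powi (k * k + k * (1 + e))
        * ((c * X\<^sup>2 * q powi (2 + e)) * (q\<^sup>2) powi k)"
    using assms by (simp add: power_int_add power_int_mult power2_eq_square power_int_mult_distrib mult.commute[of k 2])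
qed (use assms norm_q power_less_one_iff[of "norm q" 2] in \<open>auto simp: norm_power\<close>)

text \<open>
  Expand the product of the two theta series as a double sum over \<open>(i, j)\<close>.  Substituting
  \<open>i = k + e - l\<close> and \<open>j = k + l\<close>, where \<open>e\<close> is the parity of \<open>i + j\<close>, separates the quadratic form in the
  exponent of \<open>q\<close>, and the sign of the term depends only on \<open>e\<close>.
\<close>

lemma theta2_determinant:
  assumes [simp]: "c \<noteq> 0" "X \<noteq> 0" "Y \<noteq> 0"
  shows "Y * (jtheta (X / Y) * jtheta (c * (q * q) * X * Y))
       = theta2 c 0 X * theta2 c 1 Y - theta2 c 1 X * theta2 c 0 Y"
proof -
  define s t where "s i = q powi tri i * (- (X / Y)) powi i"
    and "t j = q powi tri j * (- (c * (q * q) * X * Y)) powi j" for i j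
  define f where "f = (\<lambda>(i, j). s i * t j)"
  define h where "h = (\<lambda>e Z k. c powi k * Z powi (2 * k + e) * q powi (k * k + k * (1 + e)))"
  define S where "S e = {(i, j :: int). even (i + j + e)}" for e :: int
  have ss: "s abs_summable_on UNIV" and ts: "t abs_summable_on UNIV"
    unfolding s_def t_def by (rule jtheta_abs_summable; simp)+
  have fs: "f summable_on A" for A
    using summable_on_subset_banach[OF abs_summable_summable[OF abs_summable_on_times[OF ss ts]], of A]
    by (simp add: f_def)
  have hs: "h e Z abs_summable_on UNIV" if "Z \<noteq> 0" for e Z
    unfolding h_def by (rule theta2_abs_summable) (use that in auto)
  have sign: "(- 1 :: complex) powi (k + e - l) * (- 1) powi (k + l) = (- 1) powi e" for k l e :: int
  proof -
    have "(- 1 :: complex) powi (k + e - l) * (- 1) powi (k + l) = (- 1) powi ((k + e - l) + (k + l))"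
      by (subst power_int_add) auto
    also have "(k + e - l) + (k + l) = 2 * k + e" by simp
    also have "(- 1 :: complex) powi (2 * k + e) = ((- 1) powi 2) powi k * (- 1) powi e"
      by (simp add: power_int_add power_int_mult)
    finally show ?thesis by simp
  qed
  have mon: "Y * f (k + e - l, k + l) = (- 1) powi e * (h e X k * h (1 - e) Y l)"
    if "e = 0 \<or> e = 1" for k l e :: int
  proof -
    have m1: "(- Z) powi i = (- 1) powi i * Z powi i" for Z :: complex and i
      by (metis mult_minus1 power_int_mult_distrib)
    have Y: "exp (1 * Ln Y) = Y" by simp
    have "Y * f (k + e - l, k + l) = ((- 1) powi (k + e - l) * (- 1) powi (k + l)) *
        (exp (1 * Ln Y) * (q powi tri (k + e - l) * (X / Y) powi (k + e - l)) *
         (q powi tri (k + l) * (c * (q * q) * X * Y) powi (k + l)))"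
      unfolding Y by (simp add: f_def s_def t_def m1[of "X / Y"] m1[of "c * (q * q) * X * Y"])
    also have "exp (1 * Ln Y) * (q powi tri (k + e - l) * (X / Y) powi (k + e - l)) *
         (q powi tri (k + l) * (c * (q * q) * X * Y) powi (k + l)) = h e X k * h (1 - e) Y l"
      unfolding h_def power_int_mult_distrib power_int_divide_distrib
      using that
      by (elim disjE; simp del: exp_Ln add: powi_eq_exp of_int_tri flip: exp_add exp_diff)
         (rule arg_cong[of _ _ exp], simp add: field_simps)+
    finally show ?thesis by (simp only: sign)
  qed
  (* The parity class e of the double sum factorizes, and gives one of the two terms of the determinant. *)
  have half: "Y * infsum f (S e) = (- 1) powi e * (theta2 c e X * theta2 c (1 - e) Y)"
    if e: "e = 0 \<or> e = 1" for e
  proof -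
    have bij: "bij_betw (\<lambda>(k, l). (k + e - l, k + l)) UNIV (S e)"
    proof (rule bij_betw_byWitness[of _ "\<lambda>(i, j). ((i + j - e) div 2, (j - i + e) div 2)"])
      have "((i + j - e) div 2 + e - (j - i + e) div 2 = i) \<and> ((i + j - e) div 2 + (j - i + e) div 2 = j)"
        if "even (i + j + e)" for i j
        using that by presburger
      then show "\<forall>p\<in>S e. (\<lambda>(k, l). (k + e - l, k + l)) ((\<lambda>(i, j). ((i + j - e) div 2, (j - i + e) div 2)) p) = p"
        by (auto simp: S_def)
    qed (auto simp: S_def)
    have "Y * infsum f (S e) = (\<Sum>\<^sub>\<infinity>(k, l)\<in>UNIV. Y * f (k + e - l, k + l))"
      using infsum_reindex_bij_betw[OF bij, of f]
      by (simp add: case_prod_unfold infsum_cmult_right')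
    also have "\<dots> = (- 1) powi e * (\<Sum>\<^sub>\<infinity>(k, l)\<in>UNIV \<times> UNIV. h e X k * h (1 - e) Y l)"
      by (simp add: mon[OF e] case_prod_unfold infsum_cmult_right')
    also have "\<dots> = (- 1) powi e * (theta2 c e X * theta2 c (1 - e) Y)"
      by (subst infsum_times[OF hs hs, symmetric]) (simp_all add: h_def theta2_def)
    finally show ?thesis .
  qed
  have "jtheta (X / Y) * jtheta (c * (q * q) * X * Y) = infsum f UNIV"
    using infsum_times[OF ss ts] by (simp add: jtheta_def s_def t_def f_def)
  also have "(UNIV :: (int \<times> int) set) = S 0 \<union> S 1" by (auto simp: S_def)
  also have "infsum f (S 0 \<union> S 1) = infsum f (S 0) + infsum f (S 1)"
    by (rule infsum_Un_disjoint[OF fs fs]) (auto simp: S_def)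
  finally show ?thesis using half[of 0] half[of 1] by (simp add: distrib_left)
qed

end

section \<open>A bilateral series in the plane of level-two theta functions\<close>

context nome
begin

lemma q_powi_plus_1: "q powi (n + 1) = q * q powi n"
  by (simp add: power_int_add)

text \<open>
  The first expansion of Euler with all terms replaced by their norms.
\<close>

definition euler_majorant :: "real \<Rightarrow> real" where
  "euler_majorant y = (\<Sum>k. norm (euler_coeff k) * y ^ k)"

lemma summable_euler_majorant: "summable (\<lambda>k. norm (euler_coeff k) * y ^ k)" if "y \<ge> 0"
  using summable_euler_coeff[of "of_real y"] that by (simp add: norm_mult norm_power)

lemma euler_majorant_mono: "0 \<le> y \<Longrightarrow> y \<le> z \<Longrightarrow> euler_majorant y \<le> euler_majorant z"
  unfolding euler_majorant_def
  by (intro suminf_le summable_euler_majorant mult_left_mono power_mono) auto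

lemma euler_majorant_nonneg: "0 \<le> y \<Longrightarrow> 0 \<le> euler_majorant y"
  unfolding euler_majorant_def by (intro suminf_nonneg summable_euler_majorant) auto

text \<open>
  The inequality that remains of \<open>f z = (1 + z) * f (q * z)\<close> after taking norms; it controls the majorant along geometric progressions.
\<close>

lemma euler_majorant_dilate:
  assumes z: "z \<ge> 0"
  shows "euler_majorant z \<le> (1 + z) * euler_majorant (norm q * z)"
proof -
  define r where "r = norm q"
  define b where "b k = norm (euler_coeff k)" for k
  have rz: "r * z \<ge> 0" using z by (simp add: r_def)
  have sz: "summable (\<lambda>k. b k * z ^ k)" and sr: "summable (\<lambda>k. b k * (r * z) ^ k)"
    unfolding b_def by (rule summable_euler_majorant; use z rz in simp)+
  have step: "b (Suc k) * z ^ Suc k \<le> b (Suc k) * (r * z) ^ Suc k + z * (b k * (r * z) ^ k)" for k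
  proof -
    have "1 - r ^ Suc k \<le> norm (1 - q ^ Suc k)"
      using norm_triangle_ineq2[of 1 "q ^ Suc k"] unfolding r_def norm_power by simp
    then have "b (Suc k) * (1 - r ^ Suc k) \<le> b (Suc k) * norm (1 - q ^ Suc k)"
      by (rule mult_left_mono) (simp add: b_def)
    also have "\<dots> = b k * r ^ k"
      unfolding b_def norm_mult[symmetric] euler_coeff_Suc by (simp add: norm_mult norm_power r_def)
    finally have "b (Suc k) * (1 - r ^ Suc k) * z ^ Suc k \<le> b k * r ^ k * z ^ Suc k"
      by (rule mult_right_mono) (use z in simp)
    then show ?thesis by (simp add: power_mult_distrib algebra_simps)
  qed
  have "euler_majorant z = b 0 + (\<Sum>k. b (Suc k) * z ^ Suc k)"
    unfolding euler_majorant_def using suminf_split_head[OF sz] by (simp add: b_def)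
  also have "(\<Sum>k. b (Suc k) * z ^ Suc k)
      \<le> (\<Sum>k. b (Suc k) * (r * z) ^ Suc k + z * (b k * (r * z) ^ k))"
  proof (rule suminf_le[OF step])
    show "summable (\<lambda>k. b (Suc k) * z ^ Suc k)"
      using sz by (subst summable_Suc_iff)
    have "summable (\<lambda>k. b (Suc k) * (r * z) ^ Suc k)"
      using sr by (subst summable_Suc_iff)
    then show "summable (\<lambda>k. b (Suc k) * (r * z) ^ Suc k + z * (b k * (r * z) ^ k))"
      by (intro summable_add summable_mult sr)
  qed
  also have "(\<Sum>k. b (Suc k) * (r * z) ^ Suc k + z * (b k * (r * z) ^ k))
      = (\<Sum>k. b (Suc k) * (r * z) ^ Suc k) + z * (\<Sum>k. b k * (r * z) ^ k)"
  proof -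
    have "summable (\<lambda>k. b (Suc k) * (r * z) ^ Suc k)"
      using sr by (subst summable_Suc_iff)
    then show ?thesis
      by (subst suminf_add[symmetric]) (auto intro: summable_mult sr simp: suminf_mult[OF sr])
  qed
  also have "(\<Sum>k. b (Suc k) * (r * z) ^ Suc k) = euler_majorant (r * z) - b 0"
    unfolding euler_majorant_def using suminf_split_head[OF sr] by (simp add: b_def)
  also have "(\<Sum>k. b k * (r * z) ^ k) = euler_majorant (r * z)"
    by (simp add: b_def euler_majorant_def)
  finally show ?thesis by (simp add: algebra_simps r_def)
qed

definition cleared_term :: "complex \<Rightarrow> complex \<Rightarrow> complex \<Rightarrow> int \<Rightarrow> complex" where
  "cleared_term a c X n = c powi n * X powi (2 * n) * q powi (n * (n + 1))
     * (qpoch_inf (q powi (- n) / X) q * qpoch_inf (a * X * q powi (n + 1)) q)"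

text \<open>
  The bilateral series that the series of the mu-function becomes when it is cleared of its
  denominators by a theta function.
\<close>

definition cleared_series :: "complex \<Rightarrow> complex \<Rightarrow> complex \<Rightarrow> complex" where
  "cleared_series a c X = (\<Sum>\<^sub>\<infinity>n\<in>UNIV. cleared_term a c X n)"

text \<open>
  The terms of \<open>cleared_term\<close> after both infinite products are expanded by Euler.
\<close>

definition cleared_monomial :: "complex \<Rightarrow> complex \<Rightarrow> complex \<Rightarrow> int \<Rightarrow> nat \<times> nat \<Rightarrow> complex" where
  "cleared_monomial a c X n = (\<lambda>(k, l). c powi n * X powi (2 * n) * q powi (n * (n + 1))
     * ((euler_coeff k * (q powi (- n) / X) ^ k) * (euler_coeff l * (a * X * q powi (n + 1)) ^ l)))"

lemma abs_summable_euler_coeff: "(\<lambda>k. euler_coeff k * x ^ k) abs_summable_on UNIV"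
  unfolding abs_summable_on_nat_iff by (rule summable_euler_coeff)

lemma infsum_euler_coeff: "(\<Sum>\<^sub>\<infinity>k. euler_coeff k * x ^ k) = qpoch_inf x q"
  by (simp only: euler_product infsum_eq_suminf[OF summable_euler_coeff])

lemma infsum_cleared_monomial: "infsum (cleared_monomial a c X n) UNIV = cleared_term a c X n"
proof -
  have "(\<Sum>\<^sub>\<infinity>(k, l)\<in>UNIV \<times> UNIV. (euler_coeff k * (q powi (- n) / X) ^ k) * (euler_coeff l * (a * X * q powi (n + 1)) ^ l))
      = qpoch_inf (q powi (- n) / X) q * qpoch_inf (a * X * q powi (n + 1)) q"
    by (simp only: infsum_times[OF abs_summable_euler_coeff abs_summable_euler_coeff, symmetric]
          infsum_euler_coeff)
  then show ?thesis
    by (simp add: cleared_monomial_def cleared_term_def case_prod_unfold infsum_cmult_right')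
qed

lemma norm_cleared_monomial_has_sum:
  "((\<lambda>j. norm (cleared_monomial a c X n j)) has_sum
     norm (c powi n * X powi (2 * n) * q powi (n * (n + 1)))
       * (euler_majorant (norm (q powi (- n) / X)) * euler_majorant (norm (a * X * q powi (n + 1))))) UNIV"
proof -
  define f where "f x k = (of_real (norm (euler_coeff k * x ^ k)) :: complex)" for x :: complex and k
  have fs: "f x abs_summable_on UNIV" for x
    using abs_summable_euler_coeff[of x] by (simp add: f_def norm_mult norm_power)
  have fv: "infsum (f x) UNIV = of_real (euler_majorant (norm x))" for x
    unfolding euler_majorant_def
    by (subst infsum_eq_suminf)
       (use summable_euler_coeff[of x] in \<open>simp_all add: f_def[abs_def] norm_mult norm_power suminf_of_real\<close>)
  let ?x = "q powi (- n) / X" and ?y = "a * X * q powi (n + 1)"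
  have "((\<lambda>(k, l). f ?x k * f ?y l) has_sum
     of_real (euler_majorant (norm ?x)) * of_real (euler_majorant (norm ?y))) (UNIV \<times> UNIV)"
    unfolding fv[symmetric] infsum_times[OF fs fs]
    using abs_summable_summable[OF abs_summable_on_times[OF fs fs]]
    by (rule has_sum_infsum)
  then have "((\<lambda>(k, l). Re (f ?x k * f ?y l)) has_sum
     Re (of_real (euler_majorant (norm ?x)) * of_real (euler_majorant (norm ?y)))) UNIV"
    using has_sum_Re by (fastforce simp: case_prod_unfold)
  then have "((\<lambda>j. norm (c powi n * X powi (2 * n) * q powi (n * (n + 1))) * (case j of (k, l) \<Rightarrow> Re (f ?x k * f ?y l)))
     has_sum norm (c powi n * X powi (2 * n) * q powi (n * (n + 1))) *
     Re (of_real (euler_majorant (norm ?x)) * of_real (euler_majorant (norm ?y)))) UNIV"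
    by (rule has_sum_cmult_right)
  then show ?thesis
    by (simp add: cleared_monomial_def f_def case_prod_unfold norm_mult)
qed

text \<open>
  Passing from \<open>n\<close> to \<open>n + 1\<close>, the prefactor gains \<open>q powi (2 * n + 2)\<close>, while only one of the two
  majorants grows, for large \<open>n\<close> by no more than \<open>q powi (- n - 1)\<close> up to constants.  In the other direction
  the majorants exchange their roles.
\<close>

lemma cleared_monomial_majorant_summable:
  assumes [simp]: "c \<noteq> 0" "X \<noteq> 0"
  shows "(\<lambda>n. norm (c powi n * X powi (2 * n) * q powi (n * (n + 1)))
       * (euler_majorant (norm (q powi (- n) / X)) * euler_majorant (norm (a * X * q powi (n + 1)))))
     summable_on UNIV"
proof -
  define r where "r = norm q"
  have r: "0 < r" "r < 1" using norm_q by (auto simp: r_def)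
  define C where "C = norm (c * X\<^sup>2)"
  have C: "C > 0" by (simp add: C_def norm_mult norm_power)
  define N where "N n = norm (c powi n * X powi (2 * n) * q powi (n * (n + 1)))" for n
  define E F where "E n = euler_majorant (norm (q powi (- n) / X))"
    and "F n = euler_majorant (norm (a * X * q powi (n + 1)))" for n
  have N_step: "N (n + 1) = C * r powi (2 * n + 2) * N n" for n
  proof -
    have e: "(n + 1) * (n + 1 + 1) = n * (n + 1) + (2 * n + 2)" "2 * (n + 1) = 2 * n + 2"
      by (auto simp: algebra_simps)
    show ?thesis
      unfolding N_def C_def r_def e norm_power_int[symmetric] norm_mult[symmetric]
      by (rule arg_cong[of _ _ norm]) (simp add: power_int_add)
  qed
  have pos: "N n \<ge> 0" "E n \<ge> 0" "F n \<ge> 0" for n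
    by (auto simp: N_def E_def F_def intro: euler_majorant_nonneg)
  have Eq: "norm (q powi (- n) / X) = r * norm (q powi (- (n + 1)) / X)" for n
  proof -
    have "q powi (- n) = q * q powi (- (n + 1))"
      using power_int_add[of q 1 "- (n + 1)"] by simp
    then show ?thesis by (simp add: r_def norm_divide norm_mult)
  qed
  have Fq: "norm (a * X * q powi (n + 1 + 1)) = r * norm (a * X * q powi (n + 1))" for n
    unfolding q_powi_plus_1[of "n + 1"] by (simp add: r_def norm_mult)
  have E1: "E (n + 1) \<le> (1 + 1 / (norm X * r powi (n + 1))) * E n" for n
  proof -
    have "norm (q powi (- (n + 1)) / X) = 1 / (norm X * r powi (n + 1))"
      by (simp only: power_int_minus norm_divide norm_inverse norm_power_int r_def) (simp add: field_simps)
    then show ?thesis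
      using euler_majorant_dilate[of "norm (q powi (- (n + 1)) / X)"]
      unfolding E_def Eq[of n] r_def by simp
  qed
  have E2: "E n \<le> E (n + 1)" for n
    unfolding E_def Eq[of n] using r by (intro euler_majorant_mono) (auto simp: mult_left_le_one_le)
  have F1: "F n \<le> (1 + norm (a * X) * r powi (n + 1)) * F (n + 1)" for n
  proof -
    have w: "norm (a * X * q powi (n + 1)) = norm (a * X) * r powi (n + 1)"
      by (simp only: norm_mult norm_power_int r_def)
    show ?thesis
      using euler_majorant_dilate[of "norm (a * X) * r powi (n + 1)"] r
      unfolding F_def Fq[of n] w r_def[symmetric] by simp
  qed
  have F2: "F (n + 1) \<le> F n" for n
    unfolding F_def Fq[of n] using r by (intro euler_majorant_mono) (auto simp: mult_left_le_one_le)
  have lim: "(\<lambda>n. r ^ n) \<longlonglongrightarrow> 0"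
    using r by (intro LIMSEQ_power_zero) simp
  have "(\<lambda>n. N n * (E n * F n)) abs_summable_on UNIV"
  proof (rule abs_summable_on_int_ratio)
    fix n :: nat
    define m where "m = int n"
    have "N (m + 1) * (E (m + 1) * F (m + 1))
        \<le> (C * r powi (2 * m + 2) * N m) * (((1 + 1 / (norm X * r powi (m + 1))) * E m) * F m)"
      unfolding N_step using pos C r
      by (intro mult_left_mono mult_mono E1 F2) auto
    also have "\<dots> = (C * r powi (2 * m + 2) * (1 + 1 / (norm X * r powi (m + 1)))) * (N m * (E m * F m))"
      by (simp add: mult_ac)
    also have "C * r powi (2 * m + 2) * (1 + 1 / (norm X * r powi (m + 1)))
        = C * (r * r * r ^ n * r ^ n + r * r ^ n / norm X)"
      using r by (simp add: m_def power_int_add power_int_mult power2_eq_square field_simps flip: mult_2)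
    finally show "norm (N (int n + 1) * (E (int n + 1) * F (int n + 1)))
        \<le> C * (r * r * r ^ n * r ^ n + r * r ^ n / norm X) * norm (N (int n) * (E (int n) * F (int n)))"
      using pos by (simp add: m_def)
  next
    fix n :: nat
    define m where "m = - int n - 1"
    have m: "- int n = m + 1" by (simp add: m_def)
    have Nm: "N m = N (m + 1) / (C * r powi (2 * m + 2))"
      unfolding N_step using C r by simp
    have "N m * (E m * F m)
        \<le> (N (m + 1) / (C * r powi (2 * m + 2))) * (E (m + 1) * ((1 + norm (a * X) * r powi (m + 1)) * F (m + 1)))"
      unfolding Nm using pos C r
      by (intro mult_left_mono mult_mono E2 F1) auto
    also have "\<dots> = ((1 + norm (a * X) * r powi (m + 1)) / (C * r powi (2 * m + 2))) * (N (m + 1) * (E (m + 1) * F (m + 1)))"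
      by simp
    also have "(1 + norm (a * X) * r powi (m + 1)) / (C * r powi (2 * m + 2))
        = (r ^ n * r ^ n + norm (a * X) * r ^ n) / C"
    proof -
      have "2 * m + 2 = 2 * (m + 1)" by simp
      then have f: "r powi (2 * m + 2) = inverse (r ^ n * r ^ n)" "r powi (m + 1) = inverse (r ^ n)"
        unfolding m[symmetric] using r
        by (simp_all add: power_int_minus power_int_mult power2_eq_square power_mult_distrib mult.commute[of 2])
      show ?thesis unfolding f using r C by (simp add: field_simps)
    qed
    finally show "norm (N (- int n - 1) * (E (- int n - 1) * F (- int n - 1)))
        \<le> (r ^ n * r ^ n + norm (a * X) * r ^ n) / C * norm (N (- int n) * (E (- int n) * F (- int n)))"
      using pos unfolding m by (simp add: m_def)
  next
    have "(\<lambda>n. C * (r * r * r ^ n * r ^ n + r * r ^ n / norm X)) \<longlonglongrightarrow> C * (r * r * 0 * 0 + r * 0 / norm X)"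
      by (intro tendsto_intros lim) simp
    then show "(\<lambda>n. C * (r * r * r ^ n * r ^ n + r * r ^ n / norm X)) \<longlonglongrightarrow> 0" by simp
    have "(\<lambda>n. (r ^ n * r ^ n + norm (a * X) * r ^ n) / C) \<longlonglongrightarrow> (0 * 0 + norm (a * X) * 0) / C"
      using C by (intro tendsto_intros lim) simp
    then show "(\<lambda>n. (r ^ n * r ^ n + norm (a * X) * r ^ n) / C) \<longlonglongrightarrow> 0" by simp
  qed
  then show ?thesis
    using pos by (simp add: N_def E_def F_def abs_mult)
qed

lemma cleared_monomial_summable:
  assumes "c \<noteq> 0" "X \<noteq> 0"
  shows "(\<lambda>(n, j). norm (cleared_monomial a c X n j)) summable_on UNIV \<times> UNIV"
  by (rule summable_on_SigmaI[OF _ cleared_monomial_majorant_summable[OF assms]])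
     (use norm_cleared_monomial_has_sum in auto)

lemma cleared_term_abs_summable:
  assumes "c \<noteq> 0" "X \<noteq> 0"
  shows "cleared_term a c X abs_summable_on UNIV"
proof (rule Infinite_Sum.abs_summable_on_comparison_test'[OF cleared_monomial_majorant_summable[OF assms]])
  fix n
  show "norm (cleared_term a c X n) \<le> norm (c powi n * X powi (2 * n) * q powi (n * (n + 1)))
       * (euler_majorant (norm (q powi (- n) / X)) * euler_majorant (norm (a * X * q powi (n + 1))))"
    using norm_infsum_bound[of "cleared_monomial a c X n" UNIV] norm_cleared_monomial_has_sum[of a c X n]
    by (simp add: infsum_cleared_monomial infsumI has_sum_imp_summable)
qed

text \<open>
  Expand both products and sum over \<open>n\<close> first.  A monomial with exponents \<open>(k, l)\<close> contributes a
  multiple of the level-two theta function whose parity is that of \<open>l - k\<close>, shifted by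
  \<open>p = (l - k - e) div 2\<close>; completing the square shows that the multiple does not involve \<open>X\<close>.
\<close>

lemma cleared_series_in_span:
  assumes c [simp]: "c \<noteq> 0"
  shows "\<exists>\<beta>\<^sub>0 \<beta>\<^sub>1. \<forall>X. X \<noteq> 0 \<longrightarrow> cleared_series a c X = \<beta>\<^sub>0 * theta2 c 0 X + \<beta>\<^sub>1 * theta2 c 1 X"
proof -
  define p where "p e = (\<lambda>(k, l). (int l - int k - e) div 2)" for e
  define v where "v e = (\<lambda>(k, l). euler_coeff k * euler_coeff l * (a * q) ^ l
    * (c powi (- p e (k, l)) * q powi (- p e (k, l) * p e (k, l) - p e (k, l) * (1 + e))))" for e
  define S where "S e = {(k :: nat, l :: nat). even (int l - int k - e)}" for e
  have mon: "cleared_monomial a c X n j = v e j * (c powi (n + p e j) * X powi (2 * (n + p e j) + e)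
      * q powi ((n + p e j) * (n + p e j) + (n + p e j) * (1 + e)))"
    if X [simp]: "X \<noteq> 0" and "j \<in> S e" for X n j e
  proof -
    obtain k l where j: "j = (k, l)" by (cases j)
    define P where "P = p e j"
    have P: "int l = int k + 2 * P + e"
      using that by (auto simp: P_def p_def j S_def)
    have m1: "c powi n * X powi (2 * n) * q powi (n * (n + 1)) * (X * q powi n) powi (int l - int k)
       = (c powi (- P) * q powi (- P * P - P * (1 + e))) * (c powi (n + P) * X powi (2 * (n + P) + e)
      * q powi ((n + P) * (n + P) + (n + P) * (1 + e)))"
    proof -
      have "(X * q powi n) powi (int l - int k) = X powi (2 * P + e) * q powi (n * (2 * P + e))"
        unfolding P by (simp add: power_int_mult_distrib flip: power_int_mult)
      then show ?thesis
        by (simp del: exp_Ln add: powi_eq_exp flip: exp_add exp_diff exp_minus)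
           (rule arg_cong[of _ _ exp], simp add: algebra_simps)
    qed
    have nz: "X * q powi n \<noteq> 0" by simp
    have m2: "inverse Z ^ k * Z ^ l = Z powi (int l - int k)" if "Z \<noteq> 0" for Z :: complex
      using that by (simp add: power_int_diff power_inverse divide_inverse mult.commute)
    have g1: "q powi (- n) / X = inverse (X * q powi n)"
      by (simp add: power_int_minus field_simps)
    have g2: "a * X * q powi (n + 1) = (a * q) * (X * q powi n)"
      by (simp add: power_int_add)
    have "cleared_monomial a c X n j = (euler_coeff k * euler_coeff l * (a * q) ^ l) *
      (c powi n * X powi (2 * n) * q powi (n * (n + 1)) * (inverse (X * q powi n) ^ k * (X * q powi n) ^ l))"
      unfolding cleared_monomial_def j g1 g2 prod.case power_mult_distrib[of "a * q"] by (simp only: mult_ac)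
    then have "cleared_monomial a c X n j = (euler_coeff k * euler_coeff l * (a * q) ^ l) *
      (c powi n * X powi (2 * n) * q powi (n * (n + 1)) * (X * q powi n) powi (int l - int k))"
      unfolding m2[OF nz] .
    then show ?thesis
      unfolding m1 by (simp add: v_def j P_def mult_ac)
  qed
  have "cleared_series a c X = infsum (v 0) (S 0) * theta2 c 0 X + infsum (v 1) (S 1) * theta2 c 1 X"
    if X [simp]: "X \<noteq> 0" for X
  proof -
    define f where "f = (\<lambda>(j, n). cleared_monomial a c X n j)"
    have "(\<lambda>p. norm (f p)) summable_on UNIV \<times> UNIV"
      using cleared_monomial_summable[OF c X, of a] summable_on_swap[of "\<lambda>(n, j). norm (cleared_monomial a c X n j)" UNIV UNIV]
      by (simp add: f_def case_prod_unfold)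
    then have fs: "f summable_on A" for A
      using summable_on_subset_banach[OF abs_summable_summable, of f UNIV A] by simp
    have half: "infsum f (S e \<times> UNIV) = infsum (v e) (S e) * theta2 c e X" for e
    proof -
      have "infsum f (S e \<times> UNIV) = (\<Sum>\<^sub>\<infinity>j\<in>S e. \<Sum>\<^sub>\<infinity>n. cleared_monomial a c X n j)"
        using infsum_Sigma_banach[OF fs[of "S e \<times> UNIV"]] by (simp add: f_def)
      also have "\<dots> = (\<Sum>\<^sub>\<infinity>j\<in>S e. v e j * theta2 c e X)"
      proof (rule infsum_cong)
        fix j assume j: "j \<in> S e"
        let ?h = "\<lambda>k. c powi k * X powi (2 * k + e) * q powi (k * k + k * (1 + e))"
        have "(\<Sum>\<^sub>\<infinity>n. cleared_monomial a c X n j) = v e j * (\<Sum>\<^sub>\<infinity>n. ?h (n + p e j))"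
          unfolding mon[OF X j] by (rule infsum_cmult_right')
        also have "(\<Sum>\<^sub>\<infinity>n. ?h (n + p e j)) = theta2 c e X"
          unfolding theta2_def by (rule infsum_int_shift)
        finally show "(\<Sum>\<^sub>\<infinity>n. cleared_monomial a c X n j) = v e j * theta2 c e X" .
      qed
      finally show ?thesis by (simp add: infsum_cmult_left')
    qed
    have "cleared_series a c X = (\<Sum>\<^sub>\<infinity>n. \<Sum>\<^sub>\<infinity>j. cleared_monomial a c X n j)"
      by (simp add: cleared_series_def infsum_cleared_monomial)
    also have "\<dots> = (\<Sum>\<^sub>\<infinity>j. \<Sum>\<^sub>\<infinity>n. cleared_monomial a c X n j)"
      by (rule infsum_swap_banach[symmetric]) (use fs in \<open>simp add: f_def\<close>)
    also have "\<dots> = infsum f (UNIV \<times> UNIV)"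
      using infsum_Sigma_banach[OF fs[of "UNIV \<times> UNIV"]] by (simp add: f_def)
    also have "UNIV \<times> UNIV = (S 0 \<times> UNIV) \<union> (S 1 \<times> (UNIV :: int set))" by (auto simp: S_def)
    also have "infsum f \<dots> = infsum f (S 0 \<times> UNIV) + infsum f (S 1 \<times> UNIV)"
      by (rule infsum_Un_disjoint[OF fs fs]) (auto simp: S_def)
    finally show ?thesis by (simp add: half)
  qed
  then show ?thesis by blast
qed

text \<open>
  Three vectors in a plane satisfy a linear relation whose coefficients are their pairwise determinants.
\<close>

lemma cleared_series_three_term:
  assumes c: "c \<noteq> 0" and X: "X \<noteq> 0" and Y: "Y \<noteq> 0" and Z: "Z \<noteq> 0"
  shows "cleared_series a c X * (Z * (jtheta (Y / Z) * jtheta (c * (q * q) * Y * Z)))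
       = cleared_series a c Y * (Z * (jtheta (X / Z) * jtheta (c * (q * q) * X * Z)))
       - cleared_series a c Z * (Y * (jtheta (X / Y) * jtheta (c * (q * q) * X * Y)))"
proof -
  obtain b d where "\<And>X. X \<noteq> 0 \<Longrightarrow> cleared_series a c X = b * theta2 c 0 X + d * theta2 c 1 X"
    using cleared_series_in_span[OF c, of a] by blast
  then show ?thesis
    unfolding theta2_determinant[OF c Y Z] theta2_determinant[OF c X Z] theta2_determinant[OF c X Y]
    using X Y Z by (simp add: algebra_simps)
qed

text \<open>
  The index change \<open>n \<mapsto> - n - 1\<close> exchanges the two infinite products.
\<close>

lemma cleared_series_reflect:
  assumes [simp]: "a \<noteq> 0" "c \<noteq> 0" "X \<noteq> 0"
  shows "cleared_series a (a\<^sup>2 / c) (1 / (a * X)) = c * X\<^sup>2 * cleared_series a c X"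
proof -
  have "cleared_series a (a\<^sup>2 / c) (1 / (a * X)) = (\<Sum>\<^sub>\<infinity>n. cleared_term a (a\<^sup>2 / c) (1 / (a * X)) (- n - 1))"
    unfolding cleared_series_def
    by (rule infsum_reindex_bij_betw[symmetric, of "\<lambda>n. - n - 1"])
       (rule bij_betw_byWitness[of _ "\<lambda>n. - n - 1"], auto)
  also have "\<dots> = (\<Sum>\<^sub>\<infinity>n. c * X\<^sup>2 * cleared_term a c X n)"
  proof (rule infsum_cong)
    fix n
    have "(a\<^sup>2 / c) powi (- n - 1) * (1 / (a * X)) powi (2 * (- n - 1))
        = ((a\<^sup>2 / c) * (1 / (a * X))\<^sup>2) powi (- n - 1)"
      by (simp only: power_int_mult power_int_mult_distrib power_int_numeral)
    also have "(a\<^sup>2 / c) * (1 / (a * X))\<^sup>2 = inverse (c * X\<^sup>2)"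
      by (simp add: power2_eq_square field_simps)
    also have "inverse (c * X\<^sup>2) powi (- n - 1) = (c * X\<^sup>2) powi (n + 1)"
    proof -
      have "- n - 1 = - (n + 1)" by simp
      then show ?thesis by (simp only: power_int_minus power_int_inverse inverse_inverse_eq)
    qed
    also have "\<dots> = c * X\<^sup>2 * (c powi n * X powi (2 * n))"
      by (simp add: power_int_add power_int_mult power_int_mult_distrib)
    finally have 1: "(a\<^sup>2 / c) powi (- n - 1) * (1 / (a * X)) powi (2 * (- n - 1))
       = c * X\<^sup>2 * (c powi n * X powi (2 * n))" .
    have 2: "(- n - 1) * (- n - 1 + 1) = n * (n + 1)" by (simp add: algebra_simps)
    have 3: "q powi (- (- n - 1)) / (1 / (a * X)) = a * X * q powi (n + 1)" by (simp add: mult_ac add.commute)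
    have 4: "a * (1 / (a * X)) * q powi (- n - 1 + 1) = q powi (- n) / X" by simp
    show "cleared_term a (a\<^sup>2 / c) (1 / (a * X)) (- n - 1) = c * X\<^sup>2 * cleared_term a c X n"
      unfolding cleared_term_def 1 2 3 4 by (simp only: mult_ac)
  qed
  finally show ?thesis by (simp add: cleared_series_def infsum_cmult_right')
qed

lemma qpoch_inf_negative_shift:
  assumes "a \<noteq> 0"
  shows "qpoch_inf (a * q powi (- int n)) q * q ^ (n * (n + 1) div 2) = (- a) ^ n * qpoch (q / a) q n * qpoch_inf a q"
proof (induction n)
  case (Suc n)
  have "Suc n * (Suc n + 1) = n * (n + 1) + 2 * (n + 1)" by (simp add: algebra_simps)
  then have e: "Suc n * (Suc n + 1) div 2 = n * (n + 1) div 2 + Suc n" by simp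
  have s: "a * q powi (- int (Suc n)) * q = a * q powi (- int n)"
    using q_powi_plus_1[of "- int (Suc n)"] by (simp add: mult_ac)
  have sh: "qpoch_inf (a * q powi (- int (Suc n))) q
      = (1 - a * q powi (- int (Suc n))) * qpoch_inf (a * q powi (- int n)) q"
    using qpoch_inf_shift[of "a * q powi (- int (Suc n))"] unfolding s .
  have c: "q powi (- int (Suc n)) * q ^ Suc n = 1"
    unfolding power_int_minus power_int_of_nat by (rule left_inverse) simp
  have "qpoch_inf (a * q powi (- int (Suc n))) q * q ^ (Suc n * (Suc n + 1) div 2)
      = ((1 - a * q powi (- int (Suc n))) * q ^ Suc n) * (qpoch_inf (a * q powi (- int n)) q * q ^ (n * (n + 1) div 2))"
    unfolding e sh power_add by (simp only: mult_ac)
  also have "(1 - a * q powi (- int (Suc n))) * q ^ Suc n = (- a) * (1 - q / a * q ^ n)"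
  proof -
    have "(1 - a * q powi (- int (Suc n))) * q ^ Suc n = q ^ Suc n - a * (q powi (- int (Suc n)) * q ^ Suc n)"
      by (simp only: left_diff_distrib mult_1 mult.assoc)
    also have "\<dots> = (- a) * (1 - q / a * q ^ n)"
      unfolding c using assms by (simp add: field_simps)
    finally show ?thesis .
  qed
  finally show ?case unfolding Suc.IH by (simp add: qpoch_Suc mult_ac)
qed (simp add: qpoch_def)

lemma phi11_summable: "summable (\<lambda>n. norm (qpoch A q n / qpoch q q n * (-1) ^ n * q ^ (n * (n - 1) div 2) * x ^ n))"
proof (rule summable_norm_ratio)
  fix n
  let ?t = "\<lambda>n. qpoch A q n / qpoch q q n * (-1) ^ n * q ^ (n * (n - 1) div 2) * x ^ n"
  have "Suc n * (Suc n - 1) = n * (n - 1) + 2 * n" by (cases n) auto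
  then have e: "Suc n * (Suc n - 1) div 2 = n * (n - 1) div 2 + n" by simp
  have "?t (Suc n) = ?t n * ((1 - A * q ^ n) / (1 - q ^ Suc n) * (- 1) * q ^ n * x)"
    unfolding qpoch_Suc e by (simp add: power_add)
  then have "norm (?t (Suc n)) = (norm (1 - A * q ^ n) / norm (1 - q ^ Suc n) * norm q ^ n * norm x) * norm (?t n)"
    by (simp only: norm_mult norm_divide norm_power norm_minus_cancel norm_one mult_ac mult_1)
  also have "\<dots> \<le> ((1 + norm A) / (1 - norm q) * norm q ^ n * norm x) * norm (?t n)"
  proof -
    have "norm (A * q ^ n) \<le> norm A"
      using norm_q by (simp add: norm_mult norm_power mult_left_le power_le_one)
    then have "norm (1 - A * q ^ n) \<le> 1 + norm A"
      using norm_triangle_ineq4[of 1 "A * q ^ n"] by simp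
    then show ?thesis
      using one_minus_norm_q_le[of n] norm_q
      by (intro mult_right_mono frac_le) auto
  qed
  finally show "norm (?t (Suc n)) \<le> ((1 + norm A) / (1 - norm q) * norm q ^ n * norm x) * norm (?t n)" .
next
  have "(\<lambda>n. (1 + norm A) / (1 - norm q) * norm q ^ n * norm x) \<longlonglongrightarrow> (1 + norm A) / (1 - norm q) * 0 * norm x"
    using norm_q by (intro tendsto_intros norm_q_power_tendsto_0) simp
  then show "(\<lambda>n. (1 + norm A) / (1 - norm q) * norm q ^ n * norm x) \<longlonglongrightarrow> 0" by simp
qed simp

text \<open>
  At \<open>X = 1 / a\<close> the second product is \<open>qpoch_inf (q powi (n + 1)) q\<close>, which vanishes for negative \<open>n\<close>, so the series is one-sided.
\<close>

lemma cleared_series_at_inverse: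
  assumes [simp]: "a \<noteq> 0" "c \<noteq> 0"
  shows "cleared_series a c (1 / a) = qpoch_inf a q * qpoch_inf q q * phi11 (q / a) q (c / a * q)"
proof -
  have "cleared_series a c (1 / a) = (\<Sum>\<^sub>\<infinity>n. cleared_term a c (1 / a) (int n))"
    unfolding cleared_series_def
  proof (rule infsum_int_eq_infsum_nat)
    fix n :: int assume "n < 0"
    then have "q powi (n + 1) * q ^ nat (- n - 1) = q powi ((n + 1) + int (nat (- n - 1)))"
      by (simp only: power_int_add q_nz power_int_of_nat simp_thms)
    also have "\<dots> = 1" using \<open>n < 0\<close> by simp
    finally show "cleared_term a c (1 / a) n = 0"
      using qpoch_inf_eq_0 by (simp add: cleared_term_def)
  qed
  also have "\<dots> = (\<Sum>\<^sub>\<infinity>n. (qpoch_inf a q * qpoch_inf q q) *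
      (qpoch (q / a) q n / qpoch q q n * (-1) ^ n * q ^ (n * (n - 1) div 2) * (c / a * q) ^ n))"
  proof (rule infsum_cong)
    fix n :: nat
    have n1: "n * (n + 1) = n * (n + 1) div 2 + n * (n + 1) div 2"
      by (metis dvd_mult_div_cancel even_mult_iff even_plus_one_iff mult_2)
    have "n * (n + 1) = n * (n - 1) + 2 * n" by (cases n) auto
    then have n2: "n * (n + 1) div 2 = n * (n - 1) div 2 + n" by simp
    have "cleared_term a c (1 / a) (int n) = c ^ n * (1 / a) ^ (2 * n) * q ^ (n * (n + 1))
        * (qpoch_inf (a * q powi (- int n)) q * qpoch_inf (q * q ^ n) q)"
    proof -
      have "q powi (int n * (int n + 1)) = q ^ (n * (n + 1))"
        by (metis of_nat_1 of_nat_add of_nat_mult power_int_of_nat)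
      moreover have "(1 / a) powi (2 * int n) = (1 / a) ^ (2 * n)"
        by (metis of_nat_mult of_nat_numeral power_int_of_nat)
      ultimately show ?thesis by (simp add: cleared_term_def power_int_add mult.commute)
    qed
    also have "q ^ (n * (n + 1)) = q ^ (n * (n + 1) div 2) * q ^ (n * (n + 1) div 2)"
      by (metis n1 power_add)
    also have "c ^ n * (1 / a) ^ (2 * n) * (q ^ (n * (n + 1) div 2) * q ^ (n * (n + 1) div 2))
        * (qpoch_inf (a * q powi (- int n)) q * qpoch_inf (q * q ^ n) q)
      = c ^ n * (1 / a) ^ (2 * n) * q ^ (n * (n + 1) div 2) * (qpoch_inf (a * q powi (- int n)) q * q ^ (n * (n + 1) div 2))
         * qpoch_inf (q * q ^ n) q"
      by (simp only: mult_ac)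
    also have "qpoch_inf (a * q powi (- int n)) q * q ^ (n * (n + 1) div 2) = (- a) ^ n * qpoch (q / a) q n * qpoch_inf a q"
      by (rule qpoch_inf_negative_shift[OF assms(1)])
    also have "qpoch_inf (q * q ^ n) q = qpoch_inf q q / qpoch q q n"
      using qpoch_inf_split[of q n] by simp
    also have "q ^ (n * (n + 1) div 2) = q ^ (n * (n - 1) div 2) * q ^ n"
      unfolding n2 by (rule power_add)
    finally show "cleared_term a c (1 / a) (int n) = (qpoch_inf a q * qpoch_inf q q) *
      (qpoch (q / a) q n / qpoch q q n * (-1) ^ n * q ^ (n * (n - 1) div 2) * (c / a * q) ^ n)"
      by (simp add: power_minus[of a] power_mult_distrib power_divide power_mult power2_eq_square mult_ac)
  qed
  also have "\<dots> = qpoch_inf a q * qpoch_inf q q * phi11 (q / a) q (c / a * q)"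
    unfolding infsum_cmult_right' phi11_def by (subst infsum_eq_suminf[OF phi11_summable]) simp
  finally show ?thesis .
qed

end

section \<open>The series underlying the mu-function\<close>

context nome
begin

definition qpoch_ratio :: "complex \<Rightarrow> complex \<Rightarrow> int \<Rightarrow> complex" where
  "qpoch_ratio a x n = qpoch_inf (x * q powi (n + 1)) q / qpoch_inf (x / a * q powi (n + 1)) q"

definition mu_term :: "complex \<Rightarrow> complex \<Rightarrow> complex \<Rightarrow> int \<Rightarrow> complex" where
  "mu_term a x y n = q powi tri (n + 1) * (- y) powi n * qpoch_ratio a x n"

text \<open>
  The bilateral sum in the definition of \<open>mu\<close>, without \<open>exp (pi * \<i> * v)\<close>, in the multiplicative variables \<open>a\<close>, \<open>x\<close>, \<open>y\<close> for \<open>q\<^sup>\<alpha>\<close>, \<open>exp (2 * pi * \<i> * u)\<close>, \<open>exp (2 * pi * \<i> * v)\<close>.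
\<close>

definition mu_series :: "complex \<Rightarrow> complex \<Rightarrow> complex \<Rightarrow> complex" where
  "mu_series a x y = (\<Sum>\<^sub>\<infinity>n\<in>UNIV. mu_term a x y n)"

text \<open>
  The multiplicative form of not lying in the period lattice.
\<close>

definition off_lattice :: "complex \<Rightarrow> bool" where
  "off_lattice x \<longleftrightarrow> x \<noteq> 0 \<and> (\<forall>n. x \<noteq> q powi n)"

lemma off_lattice_times_powi: "off_lattice x \<Longrightarrow> off_lattice (x * q powi m)"
  unfolding off_lattice_def
proof safe
  fix n assume "\<forall>n. x \<noteq> q powi n" "x * q powi m = q powi n"
  then show False by (metis power_int_diff nonzero_mult_div_cancel_right power_int_eq_0_iff q_nz)
qed auto

lemma off_lattice_q: "off_lattice (x * q) \<longleftrightarrow> off_lattice x" "off_lattice (x / q) \<longleftrightarrow> off_lattice x"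
proof -
  have A: "off_lattice w \<Longrightarrow> off_lattice (w * q)" for w
    using off_lattice_times_powi[of w 1] by simp
  have B: "off_lattice w \<Longrightarrow> off_lattice (w / q)" for w
    using off_lattice_times_powi[of w "-1"] by (simp add: divide_inverse)
  have "x * q / q = x" "x / q * q = x" by simp_all
  then show "off_lattice (x * q) \<longleftrightarrow> off_lattice x" "off_lattice (x / q) \<longleftrightarrow> off_lattice x"
    using A[of x] B[of "x * q"] B[of x] A[of "x / q"] by metis+
qed

lemma jtheta_off_lattice: "off_lattice x \<Longrightarrow> jtheta x \<noteq> 0"
  by (simp add: off_lattice_def jtheta_nonzero)

lemma qpoch_inf_off_lattice:
  assumes "off_lattice x"
  shows "qpoch_inf (x * q powi n) q \<noteq> 0"
proof (rule qpoch_inf_nonzero)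
  fix j :: nat
  have "x * q powi n * q ^ j = x * q powi (n + int j)" by (simp add: power_int_add)
  moreover have "x * q powi (n + int j) \<noteq> q powi 0"
    using off_lattice_times_powi[OF assms] unfolding off_lattice_def by blast
  ultimately show "x * q powi n * q ^ j \<noteq> 1" by (metis power_int_0_right)
qed

text \<open>
  Write \<open>jtheta (x / a)\<close> as a multiple of \<open>jtheta (x / a * q powi (n + 1))\<close>, with a factor depending on \<open>n\<close>.
  By the triple product the latter contains the denominator of the \<open>n\<close>-th term.
\<close>

lemma jtheta_times_mu_term:
  assumes [simp]: "a \<noteq> 0" "x \<noteq> 0" "y \<noteq> 0" and off: "off_lattice (x / a)"
  shows "jtheta (x / a) * mu_term a x y n = - (qpoch_inf q q * (x / a)) * cleared_term a (y * a / x) (x / a) n"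
proof -
  define Z where "Z = x / a"
  have Z [simp]: "Z \<noteq> 0" and x: "x = a * Z" by (auto simp: Z_def)
  have nz: "qpoch_inf (Z * q powi (n + 1)) q \<noteq> 0"
    using qpoch_inf_off_lattice[OF off] by (simp add: Z_def)
  have "q / (Z * q powi (n + 1)) = q powi (- n) / Z"
    unfolding q_powi_plus_1 by (simp add: power_int_minus divide_inverse)
  then have "jtheta Z = q powi tri (n + 1) * (- Z) powi (n + 1) *
      (qpoch_inf q q * qpoch_inf (Z * q powi (n + 1)) q * qpoch_inf (q powi (- n) / Z) q)"
    using jtheta_shift[of Z "n + 1"] jacobi_triple_product[of "Z * q powi (n + 1)"] by simp
  then have "jtheta Z * mu_term a x y n = (q powi tri (n + 1) * q powi tri (n + 1)) * ((- Z) powi (n + 1) * (- y) powi n)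
     * qpoch_inf q q * (qpoch_inf (q powi (- n) / Z) q * qpoch_inf (a * Z * q powi (n + 1)) q)"
    using nz by (simp add: mu_term_def qpoch_ratio_def Z_def[symmetric] x)
  also have "q powi tri (n + 1) * q powi tri (n + 1) = q powi (n * (n + 1))"
    using two_tri[of "n + 1"] by (simp add: algebra_simps flip: power_int_add)
  also have "(- Z) powi (n + 1) * (- y) powi n = - Z * ((y / Z) powi n * Z powi (2 * n))"
  proof -
    have "(- Z) powi (n + 1) * (- y) powi n = - Z * ((- Z) * (- y)) powi n"
      by (simp only: power_int_mult_distrib) (simp add: power_int_add)
    also have "(- Z) * (- y) = (y / Z) * Z\<^sup>2" by (simp add: power2_eq_square)
    finally show ?thesis
      by (simp only: power_int_mult_distrib power_int_mult power_int_numeral)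
  qed
  also have "y / Z = y * a / x" by (simp add: Z_def)
  finally show ?thesis by (simp add: cleared_term_def Z_def[symmetric])
qed

lemma jtheta_times_mu_series:
  assumes "a \<noteq> 0" "x \<noteq> 0" "y \<noteq> 0" "off_lattice (x / a)"
  shows "jtheta (x / a) * mu_series a x y = - (qpoch_inf q q * (x / a)) * cleared_series a (y * a / x) (x / a)"
  unfolding mu_series_def cleared_series_def infsum_cmult_right'[symmetric] jtheta_times_mu_term[OF assms] ..

lemma mu_term_summable:
  assumes "a \<noteq> 0" "x \<noteq> 0" "y \<noteq> 0" "off_lattice (x / a)"
  shows "mu_term a x y summable_on UNIV"
proof -
  have "cleared_term a (y * a / x) (x / a) summable_on UNIV"
    by (rule abs_summable_summable[OF cleared_term_abs_summable]) (use assms in auto)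
  then have "(\<lambda>n. - (qpoch_inf q q * (x / a)) / jtheta (x / a) * cleared_term a (y * a / x) (x / a) n) summable_on UNIV"
    by (rule summable_on_cmult_right)
  moreover have "- (qpoch_inf q q * (x / a)) / jtheta (x / a) * cleared_term a (y * a / x) (x / a) n = mu_term a x y n" for n
  proof -
    have "- (qpoch_inf q q * (x / a)) / jtheta (x / a) * cleared_term a (y * a / x) (x / a) n
        = jtheta (x / a) * mu_term a x y n / jtheta (x / a)"
      unfolding jtheta_times_mu_term[OF assms] by simp
    then show ?thesis using jtheta_off_lattice[OF assms(4)] by simp
  qed
  ultimately show ?thesis by simp
qed

lemma mu_series_add:
  fixes f :: "int \<Rightarrow> complex"
  assumes "\<And>n. f n = b * mu_term a x y (n + i) + b' * mu_term a' x' y' (n + j)"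
    and "mu_term a x y summable_on UNIV" "mu_term a' x' y' summable_on UNIV"
  shows "(\<Sum>\<^sub>\<infinity>n\<in>UNIV. f n) = b * mu_series a x y + b' * mu_series a' x' y'"
proof -
  have sh: "(\<lambda>n. g (n + m)) summable_on UNIV" if "g summable_on UNIV" for g :: "int \<Rightarrow> complex" and m
  proof -
    have "bij_betw (\<lambda>n. n + m) UNIV UNIV"
      by (rule bij_betw_byWitness[of _ "\<lambda>n. n - m"]) auto
    from summable_on_reindex_bij_betw[OF this, of g] that show ?thesis by simp
  qed
  have "(\<Sum>\<^sub>\<infinity>n\<in>UNIV. f n) = (\<Sum>\<^sub>\<infinity>n\<in>UNIV. b * mu_term a x y (n + i)) + (\<Sum>\<^sub>\<infinity>n\<in>UNIV. b' * mu_term a' x' y' (n + j))"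
    unfolding assms(1) by (intro infsum_add summable_on_cmult_right sh assms(2,3))
  then show ?thesis by (simp only: infsum_cmult_right' infsum_int_shift mu_series_def)
qed

lemma qpoch_ratio_times_q: "qpoch_ratio a (x * q) n = qpoch_ratio a x (n + 1)"
  unfolding qpoch_ratio_def q_powi_plus_1[of "n + 1"] by (simp only: times_divide_eq_left times_divide_eq_right mult_ac)

lemma mu_term_coeff_plus_1:
  "y \<noteq> 0 \<Longrightarrow> q powi tri (n + 1 + 1) * (- y) powi (n + 1) = - y * q powi (n + 1) * (q powi tri (n + 1) * (- y) powi n)"
  unfolding tri_plus_1[of "n + 1"] by (simp add: power_int_add)

text \<open>
  For \<open>a / q\<close> the infinite product in the denominator starts one factor later.  Restoring that factor gives the
  ratio at the same index; removing the first factor of the numerator as well gives the ratio at the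
  next index.  Each reading yields one contiguous relation.
\<close>

lemma qpoch_ratio_lower:
  assumes "a \<noteq> 0" and off: "off_lattice (x / a)"
  shows "qpoch_ratio (a / q) x n = (1 - x / a * q powi (n + 1)) * qpoch_ratio a x n"
    and "qpoch_ratio (a / q) x n = (1 - x * q powi (n + 1)) * qpoch_ratio a x (n + 1)"
proof -
  have e: "x / (a / q) * q powi (n + 1) = x / a * q powi (n + 1 + 1)"
    unfolding q_powi_plus_1[of "n + 1"] by simp
  have "qpoch_inf (x / a * q powi (n + 1)) q = (1 - x / a * q powi (n + 1)) * qpoch_inf (x / a * q powi (n + 1 + 1)) q"
    using qpoch_inf_shift[of "x / a * q powi (n + 1)"] by (simp only: q_powi_plus_1[of "n + 1"] mult_ac)
  note D = this
  have gen: "N / D = f * (N / (f * D))" if "f * D \<noteq> 0" for N D f :: complex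
    using that by simp
  show "qpoch_ratio (a / q) x n = (1 - x / a * q powi (n + 1)) * qpoch_ratio a x n"
    unfolding qpoch_ratio_def e D
    by (rule gen, rule qpoch_inf_off_lattice[OF off, of "n + 1", unfolded D])
  have N: "qpoch_inf (x * q powi (n + 1)) q = (1 - x * q powi (n + 1)) * qpoch_inf (x * q powi (n + 1 + 1)) q"
    using qpoch_inf_shift[of "x * q powi (n + 1)"] by (simp only: q_powi_plus_1[of "n + 1"] mult_ac)
  show "qpoch_ratio (a / q) x n = (1 - x * q powi (n + 1)) * qpoch_ratio a x (n + 1)"
    unfolding qpoch_ratio_def e N by (simp only: times_divide_eq_right)
qed

lemma mu_series_lower_left:
  assumes "a \<noteq> 0" "x \<noteq> 0" "y \<noteq> 0" and off: "off_lattice (x / a)"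
  shows "mu_series (a / q) x y = mu_series a x y + x / (y * a) * mu_series a (x / q) y"
proof -
  have "mu_term (a / q) x y n = 1 * mu_term a x y (n + 0) + x / (y * a) * mu_term a (x / q) y (n + 1)" for n
  proof -
    have "qpoch_ratio a (x / q) (n + 1) = qpoch_ratio a x n"
      using qpoch_ratio_times_q[of a "x / q" n] by simp
    then show ?thesis
      unfolding mu_term_def mu_term_coeff_plus_1[OF assms(3)] qpoch_ratio_lower(1)[OF assms(1) off]
      using assms by (simp add: field_simps)
  qed
  then have "(\<Sum>\<^sub>\<infinity>n\<in>UNIV. mu_term (a / q) x y n) = 1 * mu_series a x y + x / (y * a) * mu_series a (x / q) y"
    by (rule mu_series_add) (use assms off_lattice_q(2)[of "x / a"] in \<open>auto intro!: mu_term_summable simp: field_simps\<close>)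
  then show ?thesis by (simp add: mu_series_def)
qed

lemma mu_series_lower_right:
  assumes "a \<noteq> 0" "x \<noteq> 0" "y \<noteq> 0" and off: "off_lattice (x / a)"
  shows "mu_series (a / q) x y = mu_series a (x * q) y + x / y * mu_series a x y"
proof -
  have "mu_term (a / q) x y n = 1 * mu_term a (x * q) y (n + 0) + x / y * mu_term a x y (n + 1)" for n
    unfolding mu_term_def mu_term_coeff_plus_1[OF assms(3)] qpoch_ratio_lower(2)[OF assms(1) off] qpoch_ratio_times_q
    using assms by (simp add: field_simps)
  then have "(\<Sum>\<^sub>\<infinity>n\<in>UNIV. mu_term (a / q) x y n) = 1 * mu_series a (x * q) y + x / y * mu_series a x y"
    by (rule mu_series_add) (use assms off_lattice_q(1)[of "x / a"] in \<open>auto intro!: mu_term_summable simp: field_simps\<close>)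
  then show ?thesis by (simp add: mu_series_def)
qed

lemma mu_series_raise:
  assumes "a \<noteq> 0" "x \<noteq> 0" "y \<noteq> 0" and off: "off_lattice (x / a)"
  shows "mu_series a (x / q) y = a * mu_series a x y + (1 - a) * mu_series (a * q) x y"
proof -
  have off': "off_lattice (x / (a * q))" "off_lattice (x / q / a)"
    using off off_lattice_q(2)[of "x / a"] by (simp_all add: field_simps)
  have "mu_term a (x / q) y n = a * mu_term a x y (n + 0) + (1 - a) * mu_term (a * q) x y (n + 0)" for n
  proof -
    have "qpoch_ratio a x n = (1 - x / (a * q) * q powi (n + 1)) * qpoch_ratio (a * q) x n"
      using qpoch_ratio_lower(1)[of "a * q" x n] off' assms by simp
    moreover have "a * (1 - x / (a * q) * q powi (n + 1)) + (1 - a) = 1 - x / q * q powi (n + 1)"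
      using assms by (simp add: field_simps)
    moreover have "qpoch_ratio a (x / q) n = (1 - x / q * q powi (n + 1)) * qpoch_ratio (a * q) x n"
      using qpoch_ratio_lower(2)[of "a * q" "x / q" n] qpoch_ratio_times_q[of "a * q" "x / q" n] off' assms
        off_lattice_q(2)[of "x / (a * q)"] by (simp add: field_simps)
    ultimately have R: "qpoch_ratio a (x / q) n = a * qpoch_ratio a x n + (1 - a) * qpoch_ratio (a * q) x n"
      by (metis distrib_right mult.assoc)
    show ?thesis
      unfolding mu_term_def R by (simp add: algebra_simps)
  qed
  then have "(\<Sum>\<^sub>\<infinity>n\<in>UNIV. mu_term a (x / q) y n) = a * mu_series a x y + (1 - a) * mu_series (a * q) x y"
    by (rule mu_series_add) (use assms off' in \<open>auto intro!: mu_term_summable\<close>)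
  then show ?thesis by (simp add: mu_series_def)
qed

lemma mu_series_shift_both:
  assumes "y \<noteq> 0"
  shows "mu_series a (x * q) (y * q) = - (mu_series a x y / (y * q))"
proof -
  have "mu_term a (x * q) (y * q) n = - 1 / (y * q) * mu_term a x y (n + 1)" for n
  proof -
    have "(- (y * q)) powi n = (- y) powi n * q powi n"
      by (simp flip: power_int_mult_distrib)
    then show ?thesis
      unfolding mu_term_def mu_term_coeff_plus_1[OF assms] qpoch_ratio_times_q q_powi_plus_1
      using assms by (simp add: field_simps)
  qed
  then have "mu_series a (x * q) (y * q) = (\<Sum>\<^sub>\<infinity>n\<in>UNIV. - 1 / (y * q) * mu_term a x y (n + 1))"
    unfolding mu_series_def by (intro infsum_cong)
  also have "\<dots> = - 1 / (y * q) * (\<Sum>\<^sub>\<infinity>n\<in>UNIV. mu_term a x y (n + 1))"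
    by (rule infsum_cmult_right')
  also have "(\<Sum>\<^sub>\<infinity>n\<in>UNIV. mu_term a x y (n + 1)) = mu_series a x y"
    unfolding mu_series_def by (rule infsum_int_shift)
  finally show ?thesis by simp
qed

lemma jtheta_inverse: "X \<noteq> 0 \<Longrightarrow> jtheta (1 / X) = - (jtheta X / X)"
proof -
  assume X: "X \<noteq> 0"
  have "jtheta (1 / X) = - (1 / X) * jtheta (q / X)"
    using jtheta_times_q[of "1 / X"] X by simp
  also have "jtheta (q / X) = jtheta X"
    using X by (simp add: jacobi_triple_product)
  finally show ?thesis by simp
qed

lemma off_lattice_inverse:
  assumes "off_lattice x"
  shows "off_lattice (1 / x)"
  unfolding off_lattice_def
proof (intro conjI allI notI)
  fix n assume "1 / x = q powi n"
  then have "x = inverse (q powi n)" by (metis inverse_eq_divide inverse_inverse_eq)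
  then have "x = q powi (- n)" by (simp add: power_int_minus)
  then show False using assms by (auto simp: off_lattice_def)
qed (use assms in \<open>auto simp: off_lattice_def\<close>)

text \<open>
  The reflection of \<open>cleared_series\<close>, seen through \<open>jtheta_times_mu_series\<close> on both sides.
\<close>

lemma mu_series_reflect:
  assumes [simp]: "a \<noteq> 0" "x \<noteq> 0" "y \<noteq> 0" and off: "off_lattice (x / a)" "off_lattice x"
  shows "jtheta x * mu_series a (a / x) (a / y) = - (y * (jtheta (x / a) * mu_series a x y))"
proof -
  have "jtheta (1 / x) * mu_series a (a / x) (a / y) = - (qpoch_inf q q * (1 / x)) * cleared_series a (a\<^sup>2 / (y * a / x)) (1 / (a * (x / a)))"
    using jtheta_times_mu_series[of a "a / x" "a / y"] off_lattice_inverse[OF off(2)]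
    by (simp add: power2_eq_square mult_ac)
  also have "cleared_series a (a\<^sup>2 / (y * a / x)) (1 / (a * (x / a))) = (x * y / a) * cleared_series a (y * a / x) (x / a)"
    by (subst cleared_series_reflect) (simp_all add: power2_eq_square field_simps)
  finally show ?thesis
    unfolding jtheta_times_mu_series[OF assms(1-3) off(1)] jtheta_inverse[OF assms(2)]
    by (simp add: field_simps)
qed

text \<open>
  The parameter \<open>c = y * a / x\<close> does not change if \<open>x\<close> and \<open>y\<close> are both multiplied by \<open>t\<close>, so the left side
  is a value of one function \<open>cleared_series a c\<close> at \<open>x * t / a\<close>.  The three-term relation with the points
  \<open>1 / a\<close>, where \<open>cleared_series\<close> is a basic hypergeometric series, and \<open>1 / y\<close>, where by reflection it is
  the series with \<open>x\<close> and \<open>y\<close> exchanged, is the assertion.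
\<close>

lemma mu_series_transform:
  assumes [simp]: "a \<noteq> 0" "x \<noteq> 0" "y \<noteq> 0" "t \<noteq> 0"
    and off: "off_lattice (x * t / a)" "off_lattice (y / a)"
  shows "a * y * t * (jtheta (x * t / a) * mu_series a (x * t) (y * t)) * (jtheta (y / a) * jtheta x)
     = a * x * jtheta (x * t) * jtheta (y * t / a) * (jtheta (y / a) * mu_series a y x)
       + y * jtheta t * jtheta (x * y * t / a) * qpoch_inf q q
         * (qpoch_inf a q * qpoch_inf q q * phi11 (q / a) q (y / x * q))"
proof -
  define c where "c = y * a / x"
  have [simp]: "c \<noteq> 0" by (simp add: c_def)
  define G where "G = cleared_series a c (x * t / a)"
  have L: "jtheta (x * t / a) * mu_series a (x * t) (y * t) = - (qpoch_inf q q * (x * t / a)) * G"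
    using jtheta_times_mu_series[of a "x * t" "y * t"] off by (simp add: G_def c_def)
  (* The value at 1 / y, in terms of the series with x and y exchanged. *)
  have R: "x * (jtheta (y / a) * mu_series a y x) = - (qpoch_inf q q * cleared_series a c (1 / y))"
  proof -
    have "cleared_series a (a\<^sup>2 / (x * a / y)) (1 / (a * (y / a))) = x * a / y * (y / a)\<^sup>2 * cleared_series a (x * a / y) (y / a)"
      by (rule cleared_series_reflect) auto
    moreover have "a\<^sup>2 / (x * a / y) = c" "1 / (a * (y / a)) = 1 / y"
      by (simp_all add: c_def power2_eq_square)
    ultimately have g: "cleared_series a c (1 / y) = x * y / a * cleared_series a (x * a / y) (y / a)"
      by (simp add: power2_eq_square)
    show ?thesis
      unfolding jtheta_times_mu_series[OF assms(1,3,2) off(2)] g by simp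
  qed
  have sh: "jtheta (w * (q * q)) = jtheta w / (q * w\<^sup>2)" if "w \<noteq> 0" for w
    using jtheta_times_q[of w] jtheta_times_q[of "w * q"] that
    by (simp add: power2_eq_square mult_ac)
  have e: "1 / a / (1 / y) = y / a" "c * (q * q) * (1 / a) * (1 / y) = 1 / x * (q * q)"
    "x * t / a / (1 / y) = x * y * t / a" "c * (q * q) * (x * t / a) * (1 / y) = t * (q * q)"
    "x * t / a / (1 / a) = x * t" "c * (q * q) * (x * t / a) * (1 / a) = y * t / a * (q * q)"
    by (simp_all add: c_def)
  have "G * (1 / y * (jtheta (y / a) * jtheta (1 / x * (q * q))))
     = cleared_series a c (1 / a) * (1 / y * (jtheta (x * y * t / a) * jtheta (t * (q * q))))
       - cleared_series a c (1 / y) * (1 / a * (jtheta (x * t) * jtheta (y * t / a * (q * q))))"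
    using cleared_series_three_term[of c "x * t / a" "1 / a" "1 / y" a] unfolding e G_def by simp
  moreover have "jtheta (1 / x * (q * q)) = - (x * jtheta x / q)"
    by (subst sh) (simp_all add: jtheta_inverse power2_eq_square)
  moreover have "jtheta (t * (q * q)) = jtheta t / (q * t\<^sup>2)"
    and "jtheta (y * t / a * (q * q)) = jtheta (y * t / a) / (q * (y * t / a)\<^sup>2)"
    by (rule sh; simp)+
  ultimately have main: "G * (1 / y * (jtheta (y / a) * (- (x * jtheta x / q))))
     = cleared_series a c (1 / a) * (1 / y * (jtheta (x * y * t / a) * (jtheta t / (q * t\<^sup>2))))
       - cleared_series a c (1 / y) * (1 / a * (jtheta (x * t) * (jtheta (y * t / a) / (q * (y * t / a)\<^sup>2))))"
    by (simp only:)
  then have main': "x * y * t\<^sup>2 * G * (jtheta (y / a) * jtheta x)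
     = a * (cleared_series a c (1 / y) * (jtheta (x * t) * jtheta (y * t / a)))
       - y * (cleared_series a c (1 / a) * (jtheta (x * y * t / a) * jtheta t))"
    by (simp add: power2_eq_square field_simps)
  have "a * y * t * (jtheta (x * t / a) * mu_series a (x * t) (y * t)) * (jtheta (y / a) * jtheta x)
     = - (qpoch_inf q q * (x * y * t\<^sup>2 * G * (jtheta (y / a) * jtheta x)))"
    unfolding L by (simp add: power2_eq_square)
  also have "\<dots> = a * (jtheta (x * t) * jtheta (y * t / a)) * (- (qpoch_inf q q * cleared_series a c (1 / y)))
       + y * jtheta t * jtheta (x * y * t / a) * qpoch_inf q q * cleared_series a c (1 / a)"
    unfolding main' by (simp add: algebra_simps)
  finally show ?thesis
    unfolding R[symmetric] cleared_series_at_inverse[OF assms(1) \<open>c \<noteq> 0\<close>]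
    by (simp add: c_def mult_ac)
qed

end

section \<open>The generalized mu-function\<close>

definition e2pi :: "complex \<Rightarrow> complex" where
  "e2pi z = exp (2 * pi * \<i> * z)"

lemma e2pi_add: "e2pi (z + w) = e2pi z * e2pi w"
  by (simp add: e2pi_def distrib_left exp_add)

lemma e2pi_diff: "e2pi (z - w) = e2pi z / e2pi w"
  by (simp add: e2pi_def right_diff_distrib exp_diff)

lemma e2pi_minus: "e2pi (- z) = 1 / e2pi z"
  by (simp add: e2pi_def exp_minus inverse_eq_divide)

lemma e2pi_nz [simp]: "e2pi z \<noteq> 0"
  by (simp add: e2pi_def)

lemma e2pi_powi: "e2pi z powi n = e2pi (of_int n * z)"
  by (simp add: e2pi_def exp_power_int mult_ac)

lemma e2pi_square: "e2pi (z / 2) * e2pi (z / 2) = e2pi z"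
  by (simp flip: e2pi_add)

lemma e2pi_1: "e2pi 1 = 1" "e2pi (1 / 2) = - 1"
  by (simp_all add: e2pi_def mult.commute)

lemma e2pi_eq_iff: "e2pi z = e2pi w \<longleftrightarrow> (\<exists>m::int. z = w + of_int m)"
proof -
  have "2 * pi * \<i> * z = 2 * pi * \<i> * w + of_int (2 * m) * pi * \<i> \<longleftrightarrow> z = w + of_int m" for m :: int
  proof -
    have "2 * pi * \<i> * w + of_int (2 * m) * pi * \<i> = (2 * pi * \<i>) * (w + of_int m)"
      by (simp add: algebra_simps)
    then show ?thesis by (simp only: mult_cancel_left) simp
  qed
  then show ?thesis by (simp only: e2pi_def exp_eq)
qed

locale modular_nome =
  fixes \<tau> q :: complex
  assumes Im_tau: "Im \<tau> > 0" and q_def: "q = exp (2 * pi * \<i> * \<tau>)"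

sublocale modular_nome \<subseteq> nome q
proof
  have "norm q = exp (- (2 * pi * Im \<tau>))"
    by (simp add: q_def norm_exp_eq_Re)
  then show "norm q < 1" using Im_tau by simp
qed (simp add: q_def)

context modular_nome
begin

lemma e2pi_tau: "e2pi \<tau> = q"
  by (simp add: e2pi_def q_def)

lemma q_powi: "q powi n = e2pi (of_int n * \<tau>)"
  unfolding e2pi_powi[symmetric] e2pi_tau ..

lemma qpow_eq: "qpow \<tau> s = e2pi (s * \<tau>)"
  by (simp add: qpow_def e2pi_def mult.assoc)

lemma off_lattice_e2pi: "w \<notin> period_lattice \<tau> \<Longrightarrow> off_lattice (e2pi w)"
  unfolding off_lattice_def q_powi e2pi_eq_iff
  by (auto simp: period_lattice_def add.commute)

text \<open>
  The index shift by one turns the exponent \<open>n * (n + 1) / 2\<close> of \<open>theta11\<close> into \<open>tri n\<close>.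
\<close>

lemma theta11_eq: "theta11 \<tau> w = - \<i> * e2pi (\<tau> / 8) / e2pi (w / 2) * jtheta (e2pi w)"
proof -
  define f where "f n = exp (2 * pi * \<i> * (of_int n + 1/2) * (w + 1/2) + pi * \<i> * (of_int n + 1/2)\<^sup>2 * \<tau>)" for n :: int
  have "theta11 \<tau> w = (\<Sum>\<^sub>\<infinity>n\<in>UNIV. f (n + (- 1)))"
    unfolding theta11_def f_def[symmetric] by (rule infsum_int_shift[symmetric])
  also have "\<dots> = (\<Sum>\<^sub>\<infinity>n\<in>UNIV. - \<i> * e2pi (\<tau> / 8) / e2pi (w / 2) * (q powi tri n * (- e2pi w) powi n))"
  proof (rule infsum_cong)
    fix n :: int
    have m: "- e2pi w = e2pi (w + 1 / 2)" by (simp add: e2pi_add e2pi_1)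
    have i: "- \<i> = e2pi (- (1 / 4))"
    proof -
      have "e2pi (- (1 / 4)) = exp (\<i> * of_real (- (pi / 2)))"
        unfolding e2pi_def by (rule arg_cong[of _ _ exp]) simp
      also have "\<dots> = cis (- (pi / 2))" by (rule cis_conv_exp[symmetric])
      finally show ?thesis by (simp add: complex_eq_iff)
    qed
    have "f (n + (- 1)) = e2pi ((of_int n - 1 / 2) * (w + 1 / 2) + (of_int n - 1 / 2)\<^sup>2 * \<tau> / 2)"
      unfolding f_def e2pi_def by (rule arg_cong[of _ _ exp]) (simp add: algebra_simps)
    also have "\<dots> = e2pi (- (1 / 4)) * e2pi (\<tau> / 8) / e2pi (w / 2) * (e2pi \<tau> powi tri n * (e2pi (w + 1 / 2)) powi n)"
      unfolding e2pi_powi of_int_tri e2pi_add[symmetric] e2pi_diff[symmetric]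
      by (rule arg_cong[of _ _ e2pi]) (simp add: power2_eq_square field_simps)
    finally show "f (n + (- 1)) = - \<i> * e2pi (\<tau> / 8) / e2pi (w / 2) * (q powi tri n * (- e2pi w) powi n)"
      unfolding m i e2pi_tau .
  qed
  finally show ?thesis unfolding infsum_cmult_right' jtheta_def .
qed

lemma mu_eq: "mu \<tau> u v \<alpha> = \<i> / e2pi (\<tau> / 8) * e2pi (\<alpha> * (u - v) / 2) * (e2pi v / jtheta (e2pi v))
    * mu_series (e2pi (\<alpha> * \<tau>)) (e2pi u) (e2pi v)"
proof -
  have "(-1) powi n * exp (2 * pi * \<i> * (of_int n + 1/2) * v) *
        qpow \<tau> (of_int n * (of_int n + 1) / 2) *
        (qpoch_inf (exp (2 * pi * \<i> * u) * qpow \<tau> (of_int n + 1)) (qpow \<tau> 1) /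
         qpoch_inf (exp (2 * pi * \<i> * u) * qpow \<tau> (of_int n - \<alpha> + 1)) (qpow \<tau> 1))
      = e2pi (v / 2) * mu_term (e2pi (\<alpha> * \<tau>)) (e2pi u) (e2pi v) n" for n
  proof -
    have 1: "exp (2 * pi * \<i> * u) = e2pi u" "qpow \<tau> 1 = q"
      by (simp_all add: e2pi_def[of u] qpow_eq e2pi_tau)
    have 2: "qpow \<tau> (of_int n + 1) = q powi (n + 1)"
      by (simp add: qpow_eq q_powi)
    have 3: "e2pi u * qpow \<tau> (of_int n - \<alpha> + 1) = e2pi u / e2pi (\<alpha> * \<tau>) * q powi (n + 1)"
      unfolding qpow_eq q_powi e2pi_add[symmetric] e2pi_diff[symmetric]
      by (rule arg_cong[of _ _ e2pi]) (simp add: algebra_simps)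
    have 4: "qpow \<tau> (of_int n * (of_int n + 1) / 2) = q powi tri (n + 1)"
      unfolding qpow_eq q_powi of_int_tri
      by (rule arg_cong[of _ _ e2pi]) (simp add: algebra_simps)
    have 5: "(-1) powi n * exp (2 * pi * \<i> * (of_int n + 1/2) * v) = e2pi (v / 2) * (- e2pi v) powi n"
    proof -
      have "exp (2 * pi * \<i> * (of_int n + 1/2) * v) = e2pi (v / 2) * e2pi v powi n"
        unfolding e2pi_powi e2pi_add[symmetric] unfolding e2pi_def
        by (rule arg_cong[of _ _ exp]) (simp add: algebra_simps)
      moreover have "(- e2pi v) powi n = (-1) powi n * e2pi v powi n"
        by (metis mult_minus1 power_int_mult_distrib)
      ultimately show ?thesis by simp
    qed
    show ?thesis
      unfolding 1 2 3 4 5 mu_term_def qpoch_ratio_def by (simp only: mult_ac)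
  qed
  then have "mu \<tau> u v \<alpha> = exp (pi * \<i> * \<alpha> * (u - v)) / theta11 \<tau> v
      * (e2pi (v / 2) * mu_series (e2pi (\<alpha> * \<tau>)) (e2pi u) (e2pi v))"
    unfolding mu_def by (simp only: infsum_cmult_right' mu_series_def)
  also have "exp (pi * \<i> * \<alpha> * (u - v)) = e2pi (\<alpha> * (u - v) / 2)"
    unfolding e2pi_def by (rule arg_cong[of _ _ exp]) (simp add: algebra_simps)
  also have "theta11 \<tau> v = - \<i> * e2pi (\<tau> / 8) / e2pi (v / 2) * jtheta (e2pi v)"
    by (rule theta11_eq)
  finally have "mu \<tau> u v \<alpha> = e2pi (\<alpha> * (u - v) / 2) / (- \<i> * e2pi (\<tau> / 8) / e2pi (v / 2) * jtheta (e2pi v))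
      * (e2pi (v / 2) * mu_series (e2pi (\<alpha> * \<tau>)) (e2pi u) (e2pi v))" .
  moreover have "e / (- \<i> * g / h * J) * (h * M) = \<i> / g * e * (h * h / J) * M"
    if "h \<noteq> 0" "g \<noteq> 0" for e g h J M :: complex
    using that by (cases "J = 0") (simp_all add: field_simps)
  ultimately show ?thesis
    by (simp only: e2pi_square e2pi_nz simp_thms)
qed

lemma mu_dom_off_lattice:
  assumes "mu_dom \<tau> u v \<alpha>"
  shows "off_lattice (e2pi u / e2pi (\<alpha> * \<tau>))" "off_lattice (e2pi v)"
  using assms off_lattice_e2pi[of "u - \<alpha> * \<tau>"] off_lattice_e2pi[of v]
  by (auto simp: mu_dom_def e2pi_diff)

lemma e2pi_half_square: "e2pi (z / 2) ^ 2 = e2pi z"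
  by (simp add: power2_eq_square e2pi_square)

context
  fixes u v \<alpha> :: complex
begin

text \<open>
  Shifting \<open>u\<close> by \<open>\<tau>\<close> or \<open>\<alpha>\<close> by one multiplies the exponential prefactor \<open>E\<close> of \<open>mu\<close> by the square roots
  \<open>s\<close> of \<open>q\<^sup>\<alpha>\<close> and \<open>w\<close> of \<open>exp (2 * pi * \<i> * (u - v))\<close>.  In these quantities the identities for shifts are
  rational consequences of the contiguous relations.
\<close>

private definition "E = e2pi (\<alpha> * (u - v) / 2)"
private definition "s = e2pi (\<alpha> * \<tau> / 2)"
private definition "w = e2pi ((u - v) / 2)"
private definition "K = \<i> / e2pi (\<tau> / 8) * (e2pi v / jtheta (e2pi v))"

private lemma nz: "E \<noteq> 0" "s \<noteq> 0" "w \<noteq> 0"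
  by (simp_all add: E_def s_def w_def)

private lemma sq: "s * s = e2pi (\<alpha> * \<tau>)" "w * w = e2pi u / e2pi v"
  unfolding s_def w_def by (simp_all only: e2pi_square e2pi_diff)

private lemma mu_00: "mu \<tau> u v \<alpha> = K * E * mu_series (s * s) (e2pi u) (e2pi v)"
  by (simp add: mu_eq K_def E_def sq)

private lemma mu_shift:
  "mu \<tau> (u + \<tau>) v \<alpha> = K * (E * s) * mu_series (s * s) (e2pi u * q) (e2pi v)"
  "mu \<tau> (u + 2 * \<tau>) v \<alpha> = K * (E * s * s) * mu_series (s * s) (e2pi u * q * q) (e2pi v)"
  "mu \<tau> (u - \<tau>) v \<alpha> = K * (E / s) * mu_series (s * s) (e2pi u / q) (e2pi v)"
proof -
  have f: "e2pi (\<alpha> * (u + \<tau> - v) / 2) = E * s" "e2pi (\<alpha> * (u + 2 * \<tau> - v) / 2) = E * s * s"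
    "e2pi (\<alpha> * (u - \<tau> - v) / 2) = E / s"
    unfolding E_def s_def e2pi_add[symmetric] e2pi_diff[symmetric]
    by (rule arg_cong[of _ _ e2pi]; simp add: field_simps)+
  have g: "e2pi (u + \<tau>) = e2pi u * q" "e2pi (u + 2 * \<tau>) = e2pi u * q * q" "e2pi (u - \<tau>) = e2pi u / q"
    unfolding mult_2 e2pi_add e2pi_diff e2pi_tau by (simp_all only: mult.assoc)
  show "mu \<tau> (u + \<tau>) v \<alpha> = K * (E * s) * mu_series (s * s) (e2pi u * q) (e2pi v)"
  "mu \<tau> (u + 2 * \<tau>) v \<alpha> = K * (E * s * s) * mu_series (s * s) (e2pi u * q * q) (e2pi v)"
  "mu \<tau> (u - \<tau>) v \<alpha> = K * (E / s) * mu_series (s * s) (e2pi u / q) (e2pi v)"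
    unfolding mu_eq K_def f g sq(1)[symmetric] by (simp_all only: mult_ac)
qed

private lemma mu_level:
  "mu \<tau> u v (\<alpha> + 1) = K * (E * w) * mu_series (s * s * q) (e2pi u) (e2pi v)"
  "mu \<tau> u v (\<alpha> - 1) = K * (E / w) * mu_series (s * s / q) (e2pi u) (e2pi v)"
proof -
  have f: "e2pi ((\<alpha> + 1) * (u - v) / 2) = E * w" "e2pi ((\<alpha> - 1) * (u - v) / 2) = E / w"
    unfolding E_def w_def e2pi_add[symmetric] e2pi_diff[symmetric]
    by (rule arg_cong[of _ _ e2pi]; simp add: field_simps)+
  have g: "e2pi ((\<alpha> + 1) * \<tau>) = s * s * q" "e2pi ((\<alpha> - 1) * \<tau>) = s * s / q"
    by (simp_all add: sq e2pi_add e2pi_diff e2pi_tau distrib_right left_diff_distrib)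
  show "mu \<tau> u v (\<alpha> + 1) = K * (E * w) * mu_series (s * s * q) (e2pi u) (e2pi v)"
    "mu \<tau> u v (\<alpha> - 1) = K * (E / w) * mu_series (s * s / q) (e2pi u) (e2pi v)"
    unfolding mu_eq K_def f g by (simp_all only: mult_ac)
qed

private lemma coeffs:
  "exp (2 * pi * \<i> * (u - v)) = w * w" "exp (pi * \<i> * (u - v)) = w" "exp (- (pi * \<i> * (u - v))) = 1 / w"
  "qpow \<tau> (\<alpha> / 2) = s" "qpow \<tau> (- \<alpha>) = 1 / (s * s)"
proof -
  show "exp (2 * pi * \<i> * (u - v)) = w * w"
    by (simp only: sq e2pi_diff[symmetric]) (simp add: e2pi_def)
  show w: "exp (pi * \<i> * (u - v)) = w"
    unfolding w_def e2pi_def by (rule arg_cong[of _ _ exp]) (simp add: algebra_simps)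
  show "exp (- (pi * \<i> * (u - v))) = 1 / w" unfolding exp_minus w by (simp add: inverse_eq_divide)
  show "qpow \<tau> (\<alpha> / 2) = s" by (simp add: qpow_eq s_def)
  show "qpow \<tau> (- \<alpha>) = 1 / (s * s)" by (simp add: qpow_eq sq e2pi_minus)
qed

lemma mu_u_plus_tau_lower:
  assumes "mu_dom \<tau> u v \<alpha>"
  shows "mu \<tau> (u + \<tau>) v \<alpha> =
          - exp (2 * pi * \<i> * (u - v)) * qpow \<tau> (\<alpha> / 2) * mu \<tau> u v \<alpha>
          + exp (pi * \<i> * (u - v)) * qpow \<tau> (\<alpha> / 2) * mu \<tau> u v (\<alpha> - 1)"
proof -
  have "mu_series (s * s / q) (e2pi u) (e2pi v)
      = mu_series (s * s) (e2pi u * q) (e2pi v) + w * w * mu_series (s * s) (e2pi u) (e2pi v)"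
    unfolding sq by (rule mu_series_lower_right) (use mu_dom_off_lattice[OF assms] in auto)
  then show ?thesis
    unfolding mu_00 mu_shift mu_level coeffs using nz by (simp add: algebra_simps)
qed

lemma mu_u_minus_tau_raise:
  assumes "mu_dom \<tau> u v \<alpha>"
  shows "mu \<tau> (u - \<tau>) v \<alpha> =
          qpow \<tau> (\<alpha> / 2) * mu \<tau> u v \<alpha>
          - 2 * \<i> * exp (- (pi * \<i> * (u - v))) * sin (pi * \<alpha> * \<tau>) * mu \<tau> u v (\<alpha> + 1)"
proof -
  have "mu_series (s * s) (e2pi u / q) (e2pi v)
      = s * s * mu_series (s * s) (e2pi u) (e2pi v) + (1 - s * s) * mu_series (s * s * q) (e2pi u) (e2pi v)"
    unfolding sq by (rule mu_series_raise) (use mu_dom_off_lattice[OF assms] in auto)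
  moreover have "2 * \<i> * sin (pi * \<alpha> * \<tau>) = s - 1 / s"
  proof -
    have e: "exp (\<i> * (pi * \<alpha> * \<tau>)) = s"
      unfolding s_def e2pi_def by (rule arg_cong[of _ _ exp]) (simp add: algebra_simps)
    show ?thesis unfolding sin_exp_eq exp_minus e by (simp add: inverse_eq_divide)
  qed
  moreover have "K * (E / s) * (s * s * A + (1 - s * s) * B) = s * (K * E * A) - 2 * \<i> * (1 / w) * S * (K * (E * w) * B)"
    if "2 * \<i> * S = s - 1 / s" for A B S
  proof -
    have "2 * \<i> * (1 / w) * S * (K * (E * w) * B) = (2 * \<i> * S) * (K * E * B)"
      using nz by simp
    then show ?thesis unfolding that using nz by (simp add: field_simps)
  qed
  ultimately show ?thesis
    unfolding mu_00 mu_shift mu_level coeffs by simp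
qed

lemma mu_u_plus_tau_twice:
  assumes "mu_dom \<tau> (u + \<tau>) v \<alpha>" "mu_dom \<tau> u v \<alpha>"
  shows "mu \<tau> (u + 2 * \<tau>) v \<alpha> =
          (1 - exp (2 * pi * \<i> * (u - v)) * q) * qpow \<tau> (\<alpha> / 2) * mu \<tau> (u + \<tau>) v \<alpha>
          + exp (2 * pi * \<i> * (u - v)) * q * mu \<tau> u v \<alpha>"
proof -
  have off: "off_lattice (e2pi u * q / (s * s))"
    using mu_dom_off_lattice[OF assms(1)] by (simp add: sq e2pi_add e2pi_tau)
  have "mu_series (s * s / q) (e2pi u * q) (e2pi v)
      = mu_series (s * s) (e2pi u * q * q) (e2pi v) + w * w * q * mu_series (s * s) (e2pi u * q) (e2pi v)"
    using mu_series_lower_right[of "s * s" "e2pi u * q" "e2pi v"] nz off by (simp add: sq(2))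
  moreover have "mu_series (s * s / q) (e2pi u * q) (e2pi v)
      = mu_series (s * s) (e2pi u * q) (e2pi v) + w * w * q / (s * s) * mu_series (s * s) (e2pi u) (e2pi v)"
    using mu_series_lower_left[of "s * s" "e2pi u * q" "e2pi v"] nz off by (simp add: sq(2))
  ultimately have m: "mu_series (s * s) (e2pi u * q * q) (e2pi v)
     = (1 - w * w * q) * mu_series (s * s) (e2pi u * q) (e2pi v) + w * w * q / (s * s) * mu_series (s * s) (e2pi u) (e2pi v)"
    by (simp add: algebra_simps)
  have "K * (E * s * s) * ((1 - w * w * q) * A + w * w * q / (s * s) * B)
      = (1 - w * w * q) * s * (K * (E * s) * A) + w * w * q * (K * E * B)" for A B
    using nz by (simp add: field_simps)
  then show ?thesis
    unfolding mu_00 mu_shift mu_level coeffs m .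
qed

lemma mu_level_three_term:
  assumes "mu_dom \<tau> u v \<alpha>"
  shows "2 * cos (pi * (u - v)) * mu \<tau> u v \<alpha> =
          (1 - qpow \<tau> (- \<alpha>)) * mu \<tau> u v (\<alpha> + 1) + mu \<tau> u v (\<alpha> - 1)"
proof -
  have "mu_series (s * s) (e2pi u / q) (e2pi v)
      = s * s * mu_series (s * s) (e2pi u) (e2pi v) + (1 - s * s) * mu_series (s * s * q) (e2pi u) (e2pi v)"
    unfolding sq by (rule mu_series_raise) (use mu_dom_off_lattice[OF assms] in auto)
  moreover have m2: "mu_series (s * s / q) (e2pi u) (e2pi v)
      = mu_series (s * s) (e2pi u) (e2pi v) + w * w / (s * s) * mu_series (s * s) (e2pi u / q) (e2pi v)"
    unfolding sq using mu_series_lower_left[of "e2pi (\<alpha> * \<tau>)" "e2pi u" "e2pi v"] mu_dom_off_lattice[OF assms] by simp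
  moreover have cs: "2 * cos (pi * (u - v)) = w + 1 / w"
  proof -
    have e: "exp (\<i> * (pi * (u - v))) = w"
      unfolding w_def e2pi_def by (rule arg_cong[of _ _ exp]) (simp add: algebra_simps)
    show ?thesis unfolding cos_exp_eq exp_minus e by (simp add: inverse_eq_divide)
  qed
  moreover have "(w + 1 / w) * (K * E * A)
      = (1 - 1 / (s * s)) * (K * (E * w) * B) + K * (E / w) * (A + w * w / (s * s) * (s * s * A + (1 - s * s) * B))" for A B
    using nz by (simp add: field_simps)
  ultimately show ?thesis
    unfolding mu_00 mu_level coeffs by simp
qed

lemma mu_plus_1:
  "mu \<tau> u v \<alpha> = exp (- (pi * \<i> * \<alpha>)) * mu \<tau> (u + 1) v \<alpha>"
  "mu \<tau> u v \<alpha> = exp (pi * \<i> * \<alpha>) * mu \<tau> u (v + 1) \<alpha>"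
proof -
  have e: "exp (- (pi * \<i> * \<alpha>)) = e2pi (- (\<alpha> / 2))" "exp (pi * \<i> * \<alpha>) = e2pi (\<alpha> / 2)"
    unfolding e2pi_def by (rule arg_cong[of _ _ exp]; simp)+
  have "e2pi (\<alpha> * (u + 1 - v) / 2) = E * e2pi (\<alpha> / 2)" "e2pi (\<alpha> * (u - (v + 1)) / 2) = E / e2pi (\<alpha> / 2)"
    unfolding E_def e2pi_add[symmetric] e2pi_diff[symmetric]
    by (rule arg_cong[of _ _ e2pi]; simp add: field_simps)+
  then show "mu \<tau> u v \<alpha> = exp (- (pi * \<i> * \<alpha>)) * mu \<tau> (u + 1) v \<alpha>"
    "mu \<tau> u v \<alpha> = exp (pi * \<i> * \<alpha>) * mu \<tau> u (v + 1) \<alpha>"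
    unfolding mu_eq e by (simp_all add: e2pi_add e2pi_1 e2pi_minus E_def)
qed

lemma mu_plus_tau_both: "mu \<tau> u v \<alpha> = mu \<tau> (u + \<tau>) (v + \<tau>) \<alpha>"
proof -
  have "jtheta (e2pi v) = - e2pi v * jtheta (e2pi v * q)" by (rule jtheta_times_q) simp
  then show ?thesis
    unfolding mu_eq by (simp add: e2pi_add e2pi_tau mu_series_shift_both)
qed

text \<open>
  The identity is \<open>mu_series_transform\<close>; what is left is to match the elementary prefactors.  For this all
  exponentials are expressed through the roots \<open>U\<close>, \<open>V\<close>, \<open>T\<close>, \<open>s\<close> and \<open>g\<close>, so that both sides become
  rational expressions.
\<close>

lemma mu_translate:
  assumes "mu_dom \<tau> (u + z) (v + z) \<alpha>" "mu_dom \<tau> v u \<alpha>"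
  shows "mu \<tau> (u + z) (v + z) \<alpha> =
          theta11 \<tau> (u + z) * theta11 \<tau> (v + z - \<alpha> * \<tau>)
            / (theta11 \<tau> (u + z - \<alpha> * \<tau>) * theta11 \<tau> (v + z))
            * exp (2 * pi * \<i> * \<alpha> * (u - v)) * mu \<tau> v u \<alpha>
          - \<i> * qpoch_inf (qpow \<tau> \<alpha>) q * (qpoch_inf q q)\<^sup>2 * qpow \<tau> ((1 - 4 * \<alpha>) / 8)
              * theta11 \<tau> z * theta11 \<tau> (u + v + z - \<alpha> * \<tau>)
            / (theta11 \<tau> u * theta11 \<tau> (v - \<alpha> * \<tau>)
               * theta11 \<tau> (u + z - \<alpha> * \<tau>) * theta11 \<tau> (v + z))
            * exp (pi * \<i> * (\<alpha> - 1) * (u - v))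
            * phi11 (qpow \<tau> (1 - \<alpha>)) q (exp (- (2 * pi * \<i> * (u - v))) * q)"
proof -
  define U V T where "U = e2pi (u / 2)" and "V = e2pi (v / 2)" and "T = e2pi (z / 2)"
  define g where "g = e2pi (\<tau> / 8)"
  have [simp]: "U \<noteq> 0" "V \<noteq> 0" "T \<noteq> 0" "g \<noteq> 0" "s \<noteq> 0" "E \<noteq> 0"
    by (simp_all add: U_def V_def T_def g_def nz)
  have x: "e2pi u = U\<^sup>2" "e2pi v = V\<^sup>2" "e2pi z = T\<^sup>2" "e2pi (\<alpha> * \<tau>) = s\<^sup>2"
    by (simp_all add: U_def V_def T_def s_def e2pi_half_square)
  define x y t a where "x = U\<^sup>2" and "y = V\<^sup>2" and "t = T\<^sup>2" and "a = s\<^sup>2"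
  (* J stands for theta values that occur in denominators, N for those in numerators. *)
  define J1 J2 J3 J4 where "J1 = jtheta (x * t / a)" and "J2 = jtheta (y * t)"
    and "J3 = jtheta (y / a)" and "J4 = jtheta x"
  define N1 N2 N3 N4 where "N1 = jtheta (x * t)" and "N2 = jtheta (y * t / a)"
    and "N3 = jtheta t" and "N4 = jtheta (x * y * t / a)"
  define M1 M2 where "M1 = mu_series a (x * t) (y * t)" and "M2 = mu_series a y x"
  define Q P \<Phi> where "Q = qpoch_inf q q" and "P = qpoch_inf a q" and "\<Phi> = phi11 (q / a) q (y / x * q)"
  note defs = x_def y_def t_def a_def
  have [simp]: "x \<noteq> 0" "y \<noteq> 0" "t \<noteq> 0" "a \<noteq> 0" by (simp_all add: defs)
  have off: "off_lattice (x * t / a)" "off_lattice (y * t)" "off_lattice (y / a)" "off_lattice x"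
    using mu_dom_off_lattice[OF assms(1)] mu_dom_off_lattice[OF assms(2)]
    by (simp_all add: e2pi_add x defs)
  have [simp]: "J1 \<noteq> 0" "J2 \<noteq> 0" "J3 \<noteq> 0" "J4 \<noteq> 0"
    unfolding J1_def J2_def J3_def J4_def by (rule jtheta_off_lattice, rule off)+
  have key: "a * y * t * (J1 * M1) * (J3 * J4) = a * x * N1 * N2 * (J3 * M2) + y * N3 * N4 * Q * (P * Q * \<Phi>)"
    using mu_series_transform[of a x y t] off
    by (simp only: J1_def J2_def J3_def J4_def N1_def N2_def N3_def N4_def M1_def M2_def Q_def P_def \<Phi>_def
        \<open>x \<noteq> 0\<close> \<open>y \<noteq> 0\<close> \<open>t \<noteq> 0\<close> \<open>a \<noteq> 0\<close> simp_thms)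
  define C where "C = - \<i> * g"
  have C: "C \<noteq> 0" "C\<^sup>2 = - (g\<^sup>2)" by (simp_all add: C_def power_mult_distrib)
  have half: "e2pi ((u + z) / 2) = U * T" "e2pi ((v + z) / 2) = V * T"
    "e2pi ((u + z - \<alpha> * \<tau>) / 2) = U * T / s" "e2pi ((v + z - \<alpha> * \<tau>) / 2) = V * T / s"
    "e2pi ((v - \<alpha> * \<tau>) / 2) = V / s" "e2pi ((u + v + z - \<alpha> * \<tau>) / 2) = U * V * T / s"
    unfolding U_def V_def T_def s_def e2pi_add[symmetric] e2pi_diff[symmetric]
    by (rule arg_cong[of _ _ e2pi]; simp add: field_simps)+
  have th: "theta11 \<tau> (u + z) = C / (U * T) * N1" "theta11 \<tau> (v + z - \<alpha> * \<tau>) = C / (V * T / s) * N2"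
    "theta11 \<tau> (u + z - \<alpha> * \<tau>) = C / (U * T / s) * J1" "theta11 \<tau> (v + z) = C / (V * T) * J2"
    "theta11 \<tau> z = C / T * N3" "theta11 \<tau> (u + v + z - \<alpha> * \<tau>) = C / (U * V * T / s) * N4"
    "theta11 \<tau> u = C / U * J4" "theta11 \<tau> (v - \<alpha> * \<tau>) = C / (V / s) * J3"
    unfolding theta11_eq half C_def g_def[symmetric] N1_def N2_def N3_def N4_def J1_def J2_def J3_def J4_def
      defs x[symmetric] e2pi_add[symmetric] e2pi_diff[symmetric] U_def[symmetric] T_def[symmetric]
    by (rule refl)+
  have E2: "exp (2 * pi * \<i> * \<alpha> * (u - v)) = E\<^sup>2"
    unfolding E_def e2pi_half_square unfolding e2pi_def by (rule arg_cong[of _ _ exp]) (simp add: algebra_simps)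
  have Ew: "exp (pi * \<i> * (\<alpha> - 1) * (u - v)) = E * V / U"
  proof -
    have "exp (pi * \<i> * (\<alpha> - 1) * (u - v)) = e2pi ((\<alpha> - 1) * (u - v) / 2)"
      unfolding e2pi_def by (rule arg_cong[of _ _ exp]) (simp add: algebra_simps)
    also have "\<dots> = E * V / U"
      unfolding E_def V_def U_def e2pi_add[symmetric] e2pi_diff[symmetric]
      by (rule arg_cong[of _ _ e2pi]) (simp add: field_simps)
    finally show ?thesis .
  qed
  have q8: "qpow \<tau> ((1 - 4 * \<alpha>) / 8) = g / s"
    unfolding qpow_eq g_def s_def e2pi_diff[symmetric]
    by (rule arg_cong[of _ _ e2pi]) (simp add: field_simps)
  have q1: "qpow \<tau> \<alpha> = a" "qpow \<tau> (1 - \<alpha>) = q / a"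
    by (simp_all add: qpow_eq x defs e2pi_diff e2pi_tau left_diff_distrib)
  have ph: "exp (- (2 * pi * \<i> * (u - v))) = y / x"
  proof -
    have "exp (- (2 * pi * \<i> * (u - v))) = e2pi (v - u)"
      unfolding e2pi_def by (rule arg_cong[of _ _ exp]) (simp add: algebra_simps)
    then show ?thesis by (simp add: e2pi_diff x defs)
  qed
  have mu1: "mu \<tau> (u + z) (v + z) \<alpha> = \<i> / g * E * (y * t / J2) * M1"
    by (simp add: mu_eq e2pi_add x defs g_def E_def J2_def M1_def)
  have mu2: "mu \<tau> v u \<alpha> = \<i> / g * (1 / E) * (x / J4) * M2"
  proof -
    have "e2pi (\<alpha> * (v - u) / 2) = 1 / E"
      unfolding E_def e2pi_minus[symmetric] by (rule arg_cong[of _ _ e2pi]) (simp add: field_simps)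
    then show ?thesis by (simp add: mu_eq x defs g_def J4_def M2_def)
  qed
  have M1: "M1 = (a * x * N1 * N2 * (J3 * M2) + y * N3 * N4 * Q * (P * Q * \<Phi>)) / (a * y * t * J1 * (J3 * J4))"
    unfolding key[symmetric] by simp
  (* In the first term the elementary factors of the theta quotient cancel completely. *)
  have first: "C / (U * T) * N1 * (C / (V * T / s) * N2) / (C / (U * T / s) * J1 * (C / (V * T) * J2)) * E\<^sup>2
       * (\<i> / g * (1 / E) * (x / J4) * M2)
     = \<i> / g * E * x * N1 * N2 * M2 / (J1 * J2 * J4)"
    using C by (simp add: field_simps power2_eq_square)
  (* In the second one two of the factors C remain in the denominator. *)
  have N: "C / T * N3 * (C / (U * V * T / s) * N4) / (C / U * J4 * (C / (V / s) * J3) * (C / (U * T / s) * J1) * (C / (V * T) * J2))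
     = U * V / s * N3 * N4 / (C\<^sup>2 * (J1 * J2 * J3 * J4))"
    using C by (simp add: field_simps power2_eq_square)
  have "p * A * B / D * F * G = p * (A * B / D) * F * G" for p A B D F G :: complex
    by simp
  then have "\<i> * P * Q\<^sup>2 * (g / s) * (C / T * N3) * (C / (U * V * T / s) * N4)
      / (C / U * J4 * (C / (V / s) * J3) * (C / (U * T / s) * J1) * (C / (V * T) * J2)) * (E * V / U) * \<Phi>
     = \<i> * P * Q\<^sup>2 * (g / s) * (U * V / s * N3 * N4 / (C\<^sup>2 * (J1 * J2 * J3 * J4))) * (E * V / U) * \<Phi>"
    unfolding N[symmetric] .
  also have "\<dots> = - (\<i> / g * E * (y / a) * N3 * N4 * Q\<^sup>2 * P * \<Phi> / (J1 * J2 * J3 * J4))"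
    unfolding C(2) by (simp add: field_simps power2_eq_square defs)
  finally have second: "\<i> * P * Q\<^sup>2 * (g / s) * (C / T * N3) * (C / (U * V * T / s) * N4)
      / (C / U * J4 * (C / (V / s) * J3) * (C / (U * T / s) * J1) * (C / (V * T) * J2)) * (E * V / U) * \<Phi>
      = - (\<i> / g * E * (y / a) * N3 * N4 * Q\<^sup>2 * P * \<Phi> / (J1 * J2 * J3 * J4))" .
  have "\<i> / g * E * (y * t / J2) * M1 = \<i> / g * E * x * N1 * N2 * M2 / (J1 * J2 * J4)
     - - (\<i> / g * E * (y / a) * N3 * N4 * Q\<^sup>2 * P * \<Phi> / (J1 * J2 * J3 * J4))"
    unfolding M1 by (simp add: field_simps power2_eq_square)
  then show ?thesis
    unfolding th E2 Ew q8 q1 ph mu1 mu2 Q_def[symmetric] P_def[symmetric] \<Phi>_def[symmetric] first second .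
qed

end

lemma theta11_0: "theta11 \<tau> 0 = 0"
  by (simp add: theta11_eq e2pi_def jtheta_1)

text \<open>
  Without translation the hypergeometric term is killed by \<open>theta11 \<tau> 0 = 0\<close>.
\<close>

lemma mu_swap:
  assumes "mu_dom \<tau> u v \<alpha>" "mu_dom \<tau> v u \<alpha>"
  shows "mu \<tau> u v \<alpha> =
          theta11 \<tau> (v - \<alpha> * \<tau>) * theta11 \<tau> u / (theta11 \<tau> (u - \<alpha> * \<tau>) * theta11 \<tau> v)
            * exp (2 * pi * \<i> * \<alpha> * (u - v)) * mu \<tau> v u \<alpha>"
  using mu_translate[of u 0 v \<alpha>] assms by (simp add: theta11_0 mult_ac)

text \<open>
  The theta quotient arises from \<open>mu_series_reflect\<close> and from \<open>jtheta (a / y)\<close> in the prefactor, by inversion.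
\<close>

lemma mu_reflect:
  assumes "mu_dom \<tau> u v \<alpha>" "mu_dom \<tau> (- u + \<alpha> * \<tau>) (- v + \<alpha> * \<tau>) \<alpha>"
  shows "mu \<tau> u v \<alpha> =
          theta11 \<tau> (v - \<alpha> * \<tau>) * theta11 \<tau> u / (theta11 \<tau> (u - \<alpha> * \<tau>) * theta11 \<tau> v)
            * exp (2 * pi * \<i> * \<alpha> * (u - v)) * mu \<tau> (- u + \<alpha> * \<tau>) (- v + \<alpha> * \<tau>) \<alpha>"
proof -
  define x y a where "x = e2pi u" and "y = e2pi v" and "a = e2pi (\<alpha> * \<tau>)"
  define E where "E = e2pi (\<alpha> * (u - v) / 2)"
  have [simp]: "x \<noteq> 0" "y \<noteq> 0" "a \<noteq> 0" "E \<noteq> 0" by (simp_all add: x_def y_def a_def E_def)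
  have "off_lattice (1 / x)" "off_lattice (a / y)"
    using mu_dom_off_lattice[OF assms(2)] by (simp_all add: e2pi_diff x_def y_def a_def)
  from this[THEN off_lattice_inverse] have off: "off_lattice x" "off_lattice (y / a)" by simp_all
  have off': "off_lattice (x / a)" "off_lattice y"
    using mu_dom_off_lattice[OF assms(1)] by (simp_all add: x_def y_def a_def)
  note nz = off[THEN jtheta_off_lattice] off'[THEN jtheta_off_lattice]
  define M where "M = mu_series a x y"
  have refl: "mu_series a (a / x) (a / y) = - (y * (jtheta (x / a) * M)) / jtheta x"
    using mu_series_reflect[of a x y] off off' nz by (simp add: M_def field_simps)
  have inv: "jtheta (a / y) = - (jtheta (y / a) * a / y)"
    using jtheta_inverse[of "y / a"] by simp
  have "theta11 \<tau> (v - \<alpha> * \<tau>) * theta11 \<tau> u / (theta11 \<tau> (u - \<alpha> * \<tau>) * theta11 \<tau> v)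
      = jtheta (y / a) * jtheta x / (jtheta (x / a) * jtheta y)"
  proof -
    have "e2pi ((v - \<alpha> * \<tau>) / 2) * e2pi (u / 2) = e2pi ((u - \<alpha> * \<tau>) / 2) * e2pi (v / 2)"
      unfolding e2pi_add[symmetric] by (rule arg_cong[of _ _ e2pi]) (simp add: field_simps)
    moreover have "(k / b * A) * (k / c * B) / ((k / d * C) * (k / e * D)) = A * B / (C * D)"
      if "b * c = d * e" "k \<noteq> 0" "b \<noteq> 0" "c \<noteq> 0" "d \<noteq> 0" "e \<noteq> 0" for k b c d e A B C D :: complex
    proof -
      have "(k / b * A) * (k / c * B) = k * k / (b * c) * (A * B)"
        "(k / d * C) * (k / e * D) = k * k / (d * e) * (C * D)"
        by (simp_all add: mult_ac)
      moreover have "k * k / (d * e) \<noteq> 0" using that by simp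
      ultimately show ?thesis unfolding that(1) by (simp only: mult_divide_mult_cancel_left simp_thms)
    qed
    ultimately show ?thesis
      unfolding theta11_eq by (simp add: e2pi_diff x_def y_def a_def)
  qed
  moreover have "exp (2 * pi * \<i> * \<alpha> * (u - v)) = E * E"
    unfolding E_def e2pi_square unfolding e2pi_def by (rule arg_cong[of _ _ exp]) (simp add: algebra_simps)
  moreover have "mu \<tau> (- u + \<alpha> * \<tau>) (- v + \<alpha> * \<tau>) \<alpha>
      = \<i> / e2pi (\<tau> / 8) * (1 / E) * (a / y / jtheta (a / y)) * mu_series a (a / x) (a / y)"
  proof -
    have "e2pi (\<alpha> * (- u + \<alpha> * \<tau> - (- v + \<alpha> * \<tau>)) / 2) = 1 / E"
      unfolding E_def e2pi_minus[symmetric] by (rule arg_cong[of _ _ e2pi]) (simp add: field_simps)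
    then show ?thesis
      unfolding mu_eq by (simp add: e2pi_diff x_def y_def a_def)
  qed
  moreover have "mu \<tau> u v \<alpha> = \<i> / e2pi (\<tau> / 8) * E * (y / jtheta y) * M"
    by (simp add: mu_eq x_def y_def a_def E_def M_def)
  ultimately show ?thesis
    unfolding refl inv using nz by (simp add: mult_ac)
qed

end

theorem theorem1p3:
  fixes \<tau> q \<alpha> u v z :: complex
  assumes "Im \<tau> > 0" and "q = exp (2 * pi * \<i> * \<tau>)"
  shows
    "(mu_dom \<tau> (u + 2 * \<tau>) v \<alpha> \<and> mu_dom \<tau> (u + \<tau>) v \<alpha> \<and> mu_dom \<tau> u v \<alpha> \<longrightarrow>
        mu \<tau> (u + 2 * \<tau>) v \<alpha> =
          (1 - exp (2 * pi * \<i> * (u - v)) * q) * qpow \<tau> (\<alpha> / 2) * mu \<tau> (u + \<tau>) v \<alpha>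
          + exp (2 * pi * \<i> * (u - v)) * q * mu \<tau> u v \<alpha>)
   \<and> (mu_dom \<tau> u v \<alpha> \<and> mu_dom \<tau> (u + 1) v \<alpha> \<and> mu_dom \<tau> u (v + 1) \<alpha> \<longrightarrow>
        mu \<tau> u v \<alpha> = exp (- (pi * \<i> * \<alpha>)) * mu \<tau> (u + 1) v \<alpha>
      \<and> mu \<tau> u v \<alpha> = exp (pi * \<i> * \<alpha>) * mu \<tau> u (v + 1) \<alpha>)
   \<and> (mu_dom \<tau> (u + \<tau>) v \<alpha> \<and> mu_dom \<tau> u v \<alpha> \<and> mu_dom \<tau> u v (\<alpha> - 1) \<longrightarrow>
        mu \<tau> (u + \<tau>) v \<alpha> =
          - exp (2 * pi * \<i> * (u - v)) * qpow \<tau> (\<alpha> / 2) * mu \<tau> u v \<alpha>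
          + exp (pi * \<i> * (u - v)) * qpow \<tau> (\<alpha> / 2) * mu \<tau> u v (\<alpha> - 1))
   \<and> (mu_dom \<tau> (u - \<tau>) v \<alpha> \<and> mu_dom \<tau> u v \<alpha> \<and> mu_dom \<tau> u v (\<alpha> + 1) \<longrightarrow>
        mu \<tau> (u - \<tau>) v \<alpha> =
          qpow \<tau> (\<alpha> / 2) * mu \<tau> u v \<alpha>
          - 2 * \<i> * exp (- (pi * \<i> * (u - v))) * sin (pi * \<alpha> * \<tau>) * mu \<tau> u v (\<alpha> + 1))
   \<and> (mu_dom \<tau> (u + z) (v + z) \<alpha> \<and> mu_dom \<tau> v u \<alpha>
        \<and> theta11 \<tau> (u + z - \<alpha> * \<tau>) \<noteq> 0 \<and> theta11 \<tau> (v + z) \<noteq> 0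
        \<and> theta11 \<tau> u \<noteq> 0 \<and> theta11 \<tau> (v - \<alpha> * \<tau>) \<noteq> 0 \<longrightarrow>
        mu \<tau> (u + z) (v + z) \<alpha> =
          theta11 \<tau> (u + z) * theta11 \<tau> (v + z - \<alpha> * \<tau>)
            / (theta11 \<tau> (u + z - \<alpha> * \<tau>) * theta11 \<tau> (v + z))
            * exp (2 * pi * \<i> * \<alpha> * (u - v)) * mu \<tau> v u \<alpha>
          - \<i> * qpoch_inf (qpow \<tau> \<alpha>) q * (qpoch_inf q q)\<^sup>2 * qpow \<tau> ((1 - 4 * \<alpha>) / 8)
              * theta11 \<tau> z * theta11 \<tau> (u + v + z - \<alpha> * \<tau>)
            / (theta11 \<tau> u * theta11 \<tau> (v - \<alpha> * \<tau>)
               * theta11 \<tau> (u + z - \<alpha> * \<tau>) * theta11 \<tau> (v + z))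
            * exp (pi * \<i> * (\<alpha> - 1) * (u - v))
            * phi11 (qpow \<tau> (1 - \<alpha>)) q (exp (- (2 * pi * \<i> * (u - v))) * q))
   \<and> (mu_dom \<tau> u v \<alpha> \<and> mu_dom \<tau> (u + \<tau>) (v + \<tau>) \<alpha> \<longrightarrow>
        mu \<tau> u v \<alpha> = mu \<tau> (u + \<tau>) (v + \<tau>) \<alpha>)
   \<and> (mu_dom \<tau> u v \<alpha> \<and> mu_dom \<tau> v u \<alpha>
        \<and> theta11 \<tau> (u - \<alpha> * \<tau>) \<noteq> 0 \<and> theta11 \<tau> v \<noteq> 0 \<longrightarrow>
        mu \<tau> u v \<alpha> =
          theta11 \<tau> (v - \<alpha> * \<tau>) * theta11 \<tau> u / (theta11 \<tau> (u - \<alpha> * \<tau>) * theta11 \<tau> v)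
            * exp (2 * pi * \<i> * \<alpha> * (u - v)) * mu \<tau> v u \<alpha>)
   \<and> (mu_dom \<tau> u v \<alpha> \<and> mu_dom \<tau> (- u + \<alpha> * \<tau>) (- v + \<alpha> * \<tau>) \<alpha>
        \<and> theta11 \<tau> (u - \<alpha> * \<tau>) \<noteq> 0 \<and> theta11 \<tau> v \<noteq> 0 \<longrightarrow>
        mu \<tau> u v \<alpha> =
          theta11 \<tau> (v - \<alpha> * \<tau>) * theta11 \<tau> u / (theta11 \<tau> (u - \<alpha> * \<tau>) * theta11 \<tau> v)
            * exp (2 * pi * \<i> * \<alpha> * (u - v)) * mu \<tau> (- u + \<alpha> * \<tau>) (- v + \<alpha> * \<tau>) \<alpha>)
   \<and> (mu_dom \<tau> u v \<alpha> \<and> mu_dom \<tau> u v (\<alpha> + 1) \<and> mu_dom \<tau> u v (\<alpha> - 1) \<longrightarrow>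
        2 * cos (pi * (u - v)) * mu \<tau> u v \<alpha> =
          (1 - qpow \<tau> (- \<alpha>)) * mu \<tau> u v (\<alpha> + 1) + mu \<tau> u v (\<alpha> - 1))"
proof -
  interpret modular_nome \<tau> q
    by unfold_locales (use assms in auto)
  show ?thesis
    by (intro conjI impI; elim conjE)
       (rule mu_u_plus_tau_twice mu_plus_1 mu_u_plus_tau_lower mu_u_minus_tau_raise
          mu_translate mu_plus_tau_both mu_swap mu_reflect mu_level_three_term; assumption)+
qed

end
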